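(* Let $R>0$ and $a\ge a_0$. Let $\delta>0$ be the noise level. Suppose that $W^{h*}\in H_N^{1,h}(\Omega^h)$ satisfies $$D_N^hW_y^{h*}+\sum_{i=1}^nA_i^hW_{x_i}^{h*}+F^h(W^{h*}(\mathbf{x}^h),\mathbf{x}^h)=0\ \text{ in }\Omega^h,\qquad W^{h*}|_{\partial\Omega^h}=P^{h*},$$ and that there exist $S^h,S^{h*}\in H_N^{1,h}(\Omega^h)$ with $$S^h|_{\partial\Omega^h}=P^h,\quad\|S^h\|_{H_N^{1,h}(\Omega^h)}<R,\quad S^{h*}|_{\partial\Omega^h}=P^{h*},\quad\|S^{h*}\|_{H_N^{1,h}(\Omega^h)}<R,\quad\|S^h-S^{h*}\|_{H_N^{1,h}(\Omega^h)}<\delta.$$ Let $\lambda_2=\lambda_1(2R,A,d,N,a,b,h_0)$ and let $W^h_{\min,\lambda_2}$ be the minimizer of the functional $$J_{\lambda_2}(W^h)=\left\|\Big(D_N^hW_y^h+\sum_{i=1}^nA_i^hW_{x_i}^h+F^h(W^h(\mathbf{x}^h),\mathbf{x}^h)\Big)e^{\lambda_2 y}\right\|^2_{L_N^{2,h}(\Omega^h)}$$ on the set $\overline{B(R,P^h)}$. Let $\alpha_0\in(0,R)$ be a number and suppose that $$W^{h*}\in B(R-\alpha_0,P^{h*})\quad\text{and}\quad C_3\delta<\alpha_0 .$$ Then $W^h_{\min,\lambda_2}$ belongs to the open set $B(R,P^h)$ and the following accuracy estimate holds: $$\|W^h_{\min,\lambda_2}-W^{h*}\|_{H_N^{1,h}(\Omega^h)}\le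 C_3\delta .$$
   Context: Geometry and data. $n\ge1$, $N\ge1$, $m>1$ are integers; $A,d>0$, $1<a<b$ are numbers; points of $\mathbb{R}^{n+1}$ are $\mathbf{x}=(x_1,\dots,x_n,y)$; $\Omega=\{-A<x_1,\dots,x_n<A,\ a<y<b\}$. For $\alpha\in[-d,d]$, $\mathbf{x}_\alpha=(\alpha,0,\dots,0)$ and $\nu(\mathbf{x},\alpha)=\frac{\mathbf{x}-\mathbf{x}_\alpha}{|\mathbf{x}-\mathbf{x}_\alpha|}=(\nu_1,\dots,\nu_{n+1})$. $K\ge0$, $K\in C^2(\overline\Omega\times[-d,d]^2)$; $\mu_s\in C^2(\mathbb{R}^{n+1})$, $\mu_s\ge0$, $\mu_s=0$ outside $\Omega$. The dimension $n$, the functions $K,\mu_s$ and the arbitrary number $R>0$ are given and fixed. Matrices and nonlinearity. $\{\Psi_r\}_{r\ge0}$ is the orthonormal basis of $L_2(-d,d)$ obtained by Gram–Schmidt from $\{\alpha^r e^\alpha\}_{r\ge0}$. For $k,r=0,\dots,N-1$ (row $k$, column $r$): $(M_N)_{kr}=\int_{-d}^d\Psi_r'\Psi_k\,d\alpha$, $(A_{n+1}(\mathbf{x}))_{kr}=\int_{-d}^d\frac{\partial_\alpha\nu_{n+1}}{\nu_{n+1}}\Psi_r\Psi_k\,d\alpha$, $(A_i(\mathbf{x}))_{kr}=\int_{-d}^d\left[\frac{\nu_i}{\nu_{n+1}}\Psi_r'+\frac{\partial_\alpha\nu_i}{\nu_{n+1}}\Psi_r\right]\Psi_k\,d\alpha$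 ($i=1,\dots,n$), $D_N=M_N+A_{n+1}$. For $W=(w_0,\dots,w_{N-1})^T\in\mathbb{R}^N$, $F(W,\mathbf{x})\in\mathbb{R}^N$ has components $$F_k(W,\mathbf{x})=-\int_{-d}^d\frac{\mu_s(\mathbf{x})}{\nu_{n+1}(\mathbf{x},\alpha)}\,\frac{\partial}{\partial\alpha}\left[e^{-\sum_rw_r\Psi_r(\alpha)}\int_{-d}^dK(\mathbf{x},\alpha,\beta)e^{\sum_rw_r\Psi_r(\beta)}d\beta\right]\Psi_k(\alpha)\,d\alpha .$$ The number $a_0=a_0(A,d,N)>1$ is such that for all $a\ge a_0$ the matrix $D_N(\mathbf{x})$ is invertible for every $\mathbf{x}\in\overline\Omega$, with $D_N^{-1}$ bounded on $\overline\Omega$ by a constant $C_3$. $D_N^h,A_i^h,F^h$ are the restrictions of $D_N,A_i,F$ to $\mathbf{x}=\mathbf{x}^h\in\Omega^h$ (below). Semi-discrete spaces. For $i=1,\dots,n$ let $-A=x_{i,0}<x_{i,1}<\dots<x_{i,m}=A$ be the uniform partition with step $h\ge h_0$, $h_0>0$ fixed. For $J=(j_1,\dots,j_n)\in\{0,\dots,m\}^n$ put $X_J=(x_{1,j_1},\dots,x_{n,j_n})$; $J$ is interior if $1\le j_i\le m-1$ for all $i$. $\Omega^h=\{(X_J,y):y\in(a,b)\}$, with points denoted $\mathbf{x}^h$. The boundary $\partial\Omega^h$ consists of the points $(X_J,a)$, $(X_J,b)$ and of the points $(X_J,y)$ with $J$ not interior. A semi-discrete vector function $Q^h$ is a family of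 functions $Q_J^h(y)=Q^h(X_J,y)\in\mathbb{R}^N$. At interior $J$, $Q^h_{x_k}=\frac{Q^h_{J+e_k}(y)-Q^h_{J-e_k}(y)}{2h}$, and $Q_y^h$ is the usual $y$-derivative; differential expressions are considered only at interior $J$. Norms: $\|Q^h\|^2_{L_N^{2,h}(\Omega^h)}=\sum_{J\text{ interior}}\int_a^b|Q_J^h|^2dy$, $\|Q^h\|^2_{H_N^{1,h}(\Omega^h)}=\sum_{J\text{ interior}}\sum_{k=1}^n\int_a^b[|Q_J^h|^2+|Q_{x_k}^h(X_J,y)|^2+|\partial_yQ_J^h|^2]dy$; the (Hilbert) spaces consist of the $Q^h$ with finite norms, and $H_{N,0}^{1,h}(\Omega^h)=\{Q^h\in H_N^{1,h}(\Omega^h):Q^h|_{\partial\Omega^h}=0\}$. $P^h$ (noisy data) and $P^{h*}$ (exact data) are $N$-dimensional boundary vector functions on $\partial\Omega^h$. For $\rho>0$ and a boundary function $P$, $B(\rho,P)=\{W^h\in H_N^{1,h}(\Omega^h):W^h|_{\partial\Omega^h}=P,\ \|W^h\|_{H_N^{1,h}(\Omega^h)}<\rho\}$. Constants. $C_3$ denotes positive constants, possibly different at different places, depending only on $A,d,N,a,b,h_0,\|K\|_{C^1(\overline\Omega\times[-d,d]^2)}$. For $\rho>0$, $\lambda_1(\rho,A,d,N,a,b,h_0)\ge1$ denotes a sufficiently large number, depending only on the listed parameters, such that for $a\ge a_0$, all $\lambda\ge\lambda_1$ and all $W_1^h,W_2^h\in\overline{B(\rho,P)}$ (for any boundary function $P$),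 $$J_\lambda(W_2^h)-J_\lambda(W_1^h)-J_\lambda'(W_1^h)(W_2^h-W_1^h)\ge C_3e^{2\lambda a}\|W_2^h-W_1^h\|^2_{H_N^{1,h}(\Omega^h)},$$ where $J_\lambda$ is the functional of the claim with $\lambda$ in place of $\lambda_2$ and $J_\lambda'(W^h)\in H_{N,0}^{1,h}(\Omega^h)$ is its Fréchet derivative with respect to increments in $H_{N,0}^{1,h}(\Omega^h)$ (identified via Riesz, $J_\lambda'(W^h)(v)$ being the scalar product). For $\lambda\ge\lambda_1(\rho,\dots)$ the functional $J_\lambda$ has a unique minimizer on $\overline{B(\rho,P)}$ when this set is nonempty. *)

theory Defs
  imports "HOL-Analysis.Analysis" "HOL-Library.Function_Algebras"
begin

text \<open>
  Conventions. A point of \<open>\<real>\<^sup>n\<^sup>+\<^sup>1\<close> is a pair \<open>(x, y)\<close> of type \<open>(real^'n) \<times> real\<close>, whose norm is the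
  Euclidean one, with \<open>n = CARD('n)\<close>; vectors in \<open>\<real>\<^sup>N\<close> are of type \<open>real^'N\<close> with \<open>N = CARD('N)\<close>.
  The components of \<open>real^'N\<close> are numbered \<open>0, \<dots>, N - 1\<close> by the bijection \<open>ix\<close>, and \<open>ix1\<close> is the
  component of \<open>real^'n\<close> that plays the role of \<open>x\<^sub>1\<close>.
\<close>

definition ix :: "'N::finite \<Rightarrow> nat" where
  "ix = to_nat_on (UNIV :: 'N set)"

definition ix1 :: "'n::finite" where
  "ix1 = from_nat_into (UNIV :: 'n set) 0"


subsection \<open>Geometry and data\<close>

definition Omega :: "real \<Rightarrow> real \<Rightarrow> real \<Rightarrow> ((real^'n) \<times> real) set" where
  "Omega A a b = {(x, y). (\<forall>i. - A < x $ i \<and> x $ i < A) \<and> a < y \<and> y < b}"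

definition KDom :: "real \<Rightarrow> real \<Rightarrow> real \<Rightarrow> real \<Rightarrow> (((real^'n) \<times> real) \<times> real \<times> real) set" where
  "KDom A d a b = closure (Omega A a b) \<times> {-d..d} \<times> {-d..d}"

definition nu :: "((real^'n) \<times> real) \<Rightarrow> real \<Rightarrow> ((real^'n) \<times> real)" where
  "nu p \<alpha> = (let q = p - (axis ix1 \<alpha>, 0) in q /\<^sub>R norm q)"

text \<open>
  \<open>C\<^sup>2\<close> on a set on which derivatives within the set are unique (here a closed box or the whole
  space); on a closed box this is \<open>C\<^sup>2\<close> up to the boundary.
\<close>

definition C2_on :: "'a::real_normed_vector set \<Rightarrow> ('a \<Rightarrow> real) \<Rightarrow> bool" where
  "C2_on S f \<longleftrightarrow> (\<exists>(f' :: 'a \<Rightarrow> 'a \<Rightarrow>\<^sub>L real) (f'' :: 'a \<Rightarrow> 'a \<Rightarrow>\<^sub>L ('a \<Rightarrow>\<^sub>L real)).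
     (\<forall>p\<in>S. (f has_derivative blinfun_apply (f' p)) (at p within S)) \<and>
     (\<forall>p\<in>S. (f' has_derivative blinfun_apply (f'' p)) (at p within S)) \<and>
     continuous_on S f'')"

text \<open>
  The \<open>C\<^sup>1\<close> norm on a closed box. The first partial derivatives are continuous up to the boundary,
  so their suprema over the interior and over the closed box coincide.
\<close>

definition C1_norm :: "'a::euclidean_space set \<Rightarrow> ('a \<Rightarrow> real) \<Rightarrow> real" where
  "C1_norm S f = (SUP p\<in>S. \<bar>f p\<bar>) +
     (\<Sum>e\<in>Basis. SUP p\<in>interior S. \<bar>frechet_derivative f (at p) e\<bar>)"


subsection \<open>Orthonormal basis, matrices and nonlinearity\<close>

definition L2_ip :: "real \<Rightarrow> (real \<Rightarrow> real) \<Rightarrow> (real \<Rightarrow> real) \<Rightarrow> real" where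
  "L2_ip d f g = integral {-d..d} (\<lambda>\<alpha>. f \<alpha> * g \<alpha>)"

text \<open>Gram--Schmidt orthonormalisation of \<open>\<alpha>\<^sup>r e\<^sup>\<alpha>\<close> in \<open>L\<^sub>2(-d,d)\<close>.\<close>

fun Psi :: "real \<Rightarrow> nat \<Rightarrow> real \<Rightarrow> real" where
  "Psi d r =
     (let u = (\<lambda>\<alpha>. \<alpha> ^ r * exp \<alpha> -
                 (\<Sum>s<r. L2_ip d (\<lambda>\<beta>. \<beta> ^ r * exp \<beta>) (Psi d s) * Psi d s \<alpha>))
      in (\<lambda>\<alpha>. u \<alpha> / sqrt (L2_ip d u u)))"

declare Psi.simps [simp del]

definition M_mat :: "real \<Rightarrow> real^'N^'N" where
  "M_mat d = (\<chi> k r. integral {-d..d} (\<lambda>\<alpha>. deriv (Psi d (ix r)) \<alpha> * Psi d (ix k) \<alpha>))"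

definition A_last :: "real \<Rightarrow> ((real^'n) \<times> real) \<Rightarrow> real^'N^'N" where
  "A_last d p = (\<chi> k r. integral {-d..d} (\<lambda>\<alpha>.
     deriv (\<lambda>t. snd (nu p t)) \<alpha> / snd (nu p \<alpha>) * Psi d (ix r) \<alpha> * Psi d (ix k) \<alpha>))"

definition A_mat :: "real \<Rightarrow> 'n \<Rightarrow> ((real^'n) \<times> real) \<Rightarrow> real^'N^'N" where
  "A_mat d i p = (\<chi> k r. integral {-d..d} (\<lambda>\<alpha>.
     (fst (nu p \<alpha>) $ i / snd (nu p \<alpha>) * deriv (Psi d (ix r)) \<alpha> +
      deriv (\<lambda>t. fst (nu p t) $ i) \<alpha> / snd (nu p \<alpha>) * Psi d (ix r) \<alpha>) * Psi d (ix k) \<alpha>))"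

definition D_mat :: "real \<Rightarrow> ((real^'n) \<times> real) \<Rightarrow> real^'N^'N" where
  "D_mat d p = M_mat d + A_last d p"

definition F_vec :: "real \<Rightarrow> (((real^'n) \<times> real) \<Rightarrow> real) \<Rightarrow>
    (((real^'n) \<times> real) \<times> real \<times> real \<Rightarrow> real) \<Rightarrow> real^'N \<Rightarrow> ((real^'n) \<times> real) \<Rightarrow> real^'N" where
  "F_vec d mu K w p = (\<chi> k. - integral {-d..d} (\<lambda>\<alpha>.
     mu p / snd (nu p \<alpha>) *
     deriv (\<lambda>t. exp (- (\<Sum>r\<in>UNIV. w $ r * Psi d (ix r) t)) *
       integral {-d..d} (\<lambda>\<beta>. K (p, t, \<beta>) * exp (\<Sum>r\<in>UNIV. w $ r * Psi d (ix r) \<beta>))) \<alpha> *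
     Psi d (ix k) \<alpha>))"


subsection \<open>Semi-discrete functions\<close>

text \<open>
  A semi-discrete vector function \<open>Q\<close> is the family \<open>Q J y\<close> (\<open>J\<close> a multi-index in
  \<open>{0..m}\<^sup>n\<close>, \<open>y \<in> [a,b]\<close>), standing for its value at the point \<open>(X\<^sub>J, y)\<close>. Boundary vector functions
  are represented in the same way; only their values at boundary points are ever used.
\<close>

type_synonym ('n, 'N) sdfun = "('n \<Rightarrow> nat) \<Rightarrow> real \<Rightarrow> real^'N"

definition step :: "real \<Rightarrow> nat \<Rightarrow> real" where
  "step A m = 2 * A / real m"

definition grid_pt :: "real \<Rightarrow> nat \<Rightarrow> ('n \<Rightarrow> nat) \<Rightarrow> real^'n" where
  "grid_pt A m J = (\<chi> i. - A + real (J i) * step A m)"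

definition grid :: "nat \<Rightarrow> ('n \<Rightarrow> nat) set" where
  "grid m = {J. \<forall>i. J i \<le> m}"

definition interior_ix :: "nat \<Rightarrow> ('n \<Rightarrow> nat) set" where
  "interior_ix m = {J. \<forall>i. 1 \<le> J i \<and> J i \<le> m - 1}"

definition bdry :: "real \<Rightarrow> real \<Rightarrow> nat \<Rightarrow> (('n \<Rightarrow> nat) \<times> real) set" where
  "bdry a b m = {(J, y). J \<in> grid m \<and> y \<in> {a..b} \<and> (J \<notin> interior_ix m \<or> y = a \<or> y = b)}"

definition dx :: "real \<Rightarrow> nat \<Rightarrow> 'n \<Rightarrow> ('n::finite, 'N::finite) sdfun \<Rightarrow> ('n, 'N) sdfun" where
  "dx A m k Q J y = (Q (J(k := J k + 1)) y - Q (J(k := J k - 1)) y) /\<^sub>R (2 * step A m)"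

definition dy :: "('n::finite, 'N::finite) sdfun \<Rightarrow> ('n, 'N) sdfun" where
  "dy Q J y = vector_derivative (Q J) (at y)"

definition L2_fun :: "real \<Rightarrow> real \<Rightarrow> (real \<Rightarrow> real^'N) \<Rightarrow> bool" where
  "L2_fun a b f \<longleftrightarrow> f \<in> borel_measurable (lebesgue_on {a<..<b}) \<and>
     integrable (lebesgue_on {a<..<b}) (\<lambda>y. (norm (f y))\<^sup>2)"

text \<open>
  The Sobolev space \<open>H\<^sup>1(a,b)\<close>, as the space of absolutely continuous functions on \<open>[a,b]\<close> (that is,
  indefinite integrals of their almost everywhere derivative) with square integrable derivative.
\<close>

definition H1_fun :: "real \<Rightarrow> real \<Rightarrow> (real \<Rightarrow> real^'N) \<Rightarrow> bool" where
  "H1_fun a b f \<longleftrightarrow> L2_fun a b f \<and>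
     (AE y in lebesgue_on {a<..<b}. f differentiable (at y)) \<and>
     L2_fun a b (\<lambda>y. vector_derivative f (at y)) \<and>
     (\<forall>y\<in>{a..b}. f y = f a + integral {a..y} (\<lambda>t. vector_derivative f (at t)))"

definition H1h :: "real \<Rightarrow> real \<Rightarrow> real \<Rightarrow> nat \<Rightarrow> ('n::finite, 'N::finite) sdfun set" where
  "H1h A a b m = {Q. \<forall>J\<in>interior_ix m. H1_fun a b (Q J) \<and> (\<forall>k. L2_fun a b (dx A m k Q J))}"

definition sd_norm_L2 :: "real \<Rightarrow> real \<Rightarrow> nat \<Rightarrow> ('n::finite, 'N::finite) sdfun \<Rightarrow> real" where
  "sd_norm_L2 a b m Q =
     sqrt (\<Sum>J\<in>interior_ix m. LINT y|lebesgue_on {a<..<b}. (norm (Q J y))\<^sup>2)"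

definition sd_norm :: "real \<Rightarrow> real \<Rightarrow> real \<Rightarrow> nat \<Rightarrow> ('n::finite, 'N::finite) sdfun \<Rightarrow> real" where
  "sd_norm A a b m Q =
     sqrt (\<Sum>J\<in>interior_ix m. \<Sum>k\<in>UNIV. LINT y|lebesgue_on {a<..<b}.
       (norm (Q J y))\<^sup>2 + (norm (dx A m k Q J y))\<^sup>2 + (norm (dy Q J y))\<^sup>2)"

definition sd_inner :: "real \<Rightarrow> real \<Rightarrow> real \<Rightarrow> nat \<Rightarrow>
    ('n::finite, 'N::finite) sdfun \<Rightarrow> ('n, 'N) sdfun \<Rightarrow> real" where
  "sd_inner A a b m Q V =
     (\<Sum>J\<in>interior_ix m. \<Sum>k\<in>UNIV. LINT y|lebesgue_on {a<..<b}.
       Q J y \<bullet> V J y + dx A m k Q J y \<bullet> dx A m k V J y + dy Q J y \<bullet> dy V J y)"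

definition has_trace :: "real \<Rightarrow> real \<Rightarrow> nat \<Rightarrow> ('n::finite, 'N::finite) sdfun \<Rightarrow> ('n, 'N) sdfun \<Rightarrow> bool" where
  "has_trace a b m Q P \<longleftrightarrow> (\<forall>(J, y)\<in>bdry a b m. Q J y = P J y)"

definition H10h :: "real \<Rightarrow> real \<Rightarrow> real \<Rightarrow> nat \<Rightarrow> ('n::finite, 'N::finite) sdfun set" where
  "H10h A a b m = {Q \<in> H1h A a b m. has_trace a b m Q (\<lambda>J y. 0)}"

definition Bset :: "real \<Rightarrow> real \<Rightarrow> real \<Rightarrow> nat \<Rightarrow> real \<Rightarrow> ('n::finite, 'N::finite) sdfun \<Rightarrow>
    ('n, 'N) sdfun set" where
  "Bset A a b m \<rho> P = {W \<in> H1h A a b m. has_trace a b m W P \<and> sd_norm A a b m W < \<rho>}"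

text \<open>
  Closure of \<open>Bset\<close> in the \<open>H1h\<close> norm. The boundary condition is kept explicitly, because the norm
  involves the boundary values only through difference quotients and does not determine them.
\<close>

definition Bclosure :: "real \<Rightarrow> real \<Rightarrow> real \<Rightarrow> nat \<Rightarrow> real \<Rightarrow> ('n::finite, 'N::finite) sdfun \<Rightarrow>
    ('n, 'N) sdfun set" where
  "Bclosure A a b m \<rho> P = {W \<in> H1h A a b m. has_trace a b m W P \<and>
     (\<forall>\<epsilon>>0. \<exists>V\<in>Bset A a b m \<rho> P. sd_norm A a b m (V - W) < \<epsilon>)}"


subsection \<open>The functional\<close>

definition residual :: "real \<Rightarrow> real \<Rightarrow> nat \<Rightarrow> (((real^'n) \<times> real) \<Rightarrow> real) \<Rightarrow>
    (((real^'n) \<times> real) \<times> real \<times> real \<Rightarrow> real) \<Rightarrow> ('n::finite, 'N::finite) sdfun \<Rightarrow> ('n, 'N) sdfun" where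
  "residual A d m mu K W J y =
     (let p = (grid_pt A m J, y) in
       D_mat d p *v dy W J y + (\<Sum>i\<in>UNIV. A_mat d i p *v dx A m i W J y)
         + F_vec d mu K (W J y) p)"

definition Jfun :: "real \<Rightarrow> real \<Rightarrow> real \<Rightarrow> real \<Rightarrow> nat \<Rightarrow> (((real^'n) \<times> real) \<Rightarrow> real) \<Rightarrow>
    (((real^'n) \<times> real) \<times> real \<times> real \<Rightarrow> real) \<Rightarrow> real \<Rightarrow> ('n::finite, 'N::finite) sdfun \<Rightarrow> real" where
  "Jfun A d a b m mu K lam W =
     (sd_norm_L2 a b m (\<lambda>J y. exp (lam * y) *\<^sub>R residual A d m mu K W J y))\<^sup>2"

text \<open>
  \<open>G \<in> H10h\<close> is the Riesz representative of the Frechet derivative of \<open>\<Phi>\<close> at \<open>W\<close> with respect to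
  increments in \<open>H10h\<close>.
\<close>

definition has_frechet_gradient :: "real \<Rightarrow> real \<Rightarrow> real \<Rightarrow> nat \<Rightarrow>
    (('n::finite, 'N::finite) sdfun \<Rightarrow> real) \<Rightarrow> ('n, 'N) sdfun \<Rightarrow> ('n, 'N) sdfun \<Rightarrow> bool" where
  "has_frechet_gradient A a b m \<Phi> W G \<longleftrightarrow> G \<in> H10h A a b m \<and>
     (\<forall>\<epsilon>>0. \<exists>s>0. \<forall>v\<in>H10h A a b m. sd_norm A a b m v < s \<longrightarrow>
        \<bar>\<Phi> (W + v) - \<Phi> W - sd_inner A a b m G v\<bar> \<le> \<epsilon> * sd_norm A a b m v)"

text \<open>
  The defining property of a value \<open>lam1 = \<lambda>\<^sub>1(\<rho>, A, d, N, a, b, h\<^sub>0)\<close>, with \<open>c\<close> the constant of the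
  strong convexity estimate. Both are uniform in the grid (with step at least \<open>h0\<close>), in \<open>\<lambda> \<ge> \<lambda>\<^sub>1\<close> and
  in the boundary data.
\<close>

definition is_lambda1 :: "real \<Rightarrow> real \<Rightarrow> real \<Rightarrow> real \<Rightarrow> real \<Rightarrow> (((real^'n) \<times> real) \<Rightarrow> real) \<Rightarrow>
    (((real^'n) \<times> real) \<times> real \<times> real \<Rightarrow> real) \<Rightarrow> 'N::finite itself \<Rightarrow> real \<Rightarrow> real \<Rightarrow> real \<Rightarrow> bool" where
  "is_lambda1 A d a b h0 mu K TN \<rho> lam1 c \<longleftrightarrow> lam1 \<ge> 1 \<and> c > 0 \<and>
     (\<forall>m lam (P :: ('n, 'N) sdfun). 1 < m \<and> step A m \<ge> h0 \<and> lam \<ge> lam1 \<longrightarrow>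
       (\<forall>W1\<in>Bclosure A a b m \<rho> P. \<exists>G.
          has_frechet_gradient A a b m (Jfun A d a b m mu K lam) W1 G \<and>
          (\<forall>W2\<in>Bclosure A a b m \<rho> P.
             Jfun A d a b m mu K lam W2 - Jfun A d a b m mu K lam W1
               - sd_inner A a b m G (W2 - W1)
             \<ge> c * exp (2 * lam * a) * (sd_norm A a b m (W2 - W1))\<^sup>2)))"

end

theory Submission
  imports Defs
begin

text \<open>
  Move the exact solution to the noisy boundary data by \<open>Q = W\<^sup>* + (S - S\<^sup>*)\<close>. Since the residual of
  \<open>W\<^sup>*\<close> vanishes, the Lipschitz continuity of the operator on bounded sets gives \<open>J(Q) \<le> C \<delta>\<^sup>2\<close>, and
  strong convexity bounds \<open>\<parallel>Q - W\<^sub>m\<^sub>i\<^sub>n\<parallel>\<^sup>2\<close> by a multiple of \<open>J(Q)\<close>. The triangle inequality then yields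
  the estimate, and the gap \<open>\<alpha>\<^sub>0 > C\<^sub>3 \<delta>\<close> keeps the minimizer off the boundary of the ball.
\<close>

section \<open>Sobolev functions on an interval\<close>

text \<open>Strong convexity compares only functions with the same boundary data, which is why the
  exact solution has to be shifted before it can compete. The nonlinearity contains exponentials of
  \<open>w\<close> and is Lipschitz only on bounded sets, whereas the balls are measured in
  \<open>sd_norm\<close>. The link is the one-dimensional Sobolev embedding in \<open>y\<close>,
  applied at each grid node separately: it turns a bound on the norm into a pointwise bound, which
  fixes the set on which the Lipschitz constant is taken. The bound on J(Q) is quadratic in the
  noise level and the convexity gap is quadratic in the distance, so the final bound is linear. All
  constants have to be fixed before the kernel \<open>K\<close> is, so every estimate uses
  \<open>K\<close> only through the value \<kappa> of its C^1 norm. Derivatives in \<open>y\<close>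
  exist only almost everywhere, so linearity of \<open>dy\<close> is an almost everywhere statement
  throughout.\<close>

lemma borel_measurable_lebesgue_on_AE:
  fixes f g :: "'a::euclidean_space \<Rightarrow> 'b::euclidean_space"
  assumes f: "f \<in> borel_measurable (lebesgue_on S)" and S: "S \<in> sets lebesgue"
    and ae: "AE x in lebesgue_on S. f x = g x"
  shows "g \<in> borel_measurable (lebesgue_on S)"
proof -
  \<comment> \<open>Extension by zero moves the question to the complete measure
    \<open>lebesgue\<close>, where a modification on a null set stays measurable.\<close>
  have "AE x in lebesgue. x \<in> S \<longrightarrow> f x = g x"
    using ae S by (simp add: AE_restrict_space_iff)
  then have "AE x in lebesgue. (if x \<in> S then f x else 0) = (if x \<in> S then g x else 0)"
    by eventually_elim auto
  moreover have "(\<lambda>x. if x \<in> S then f x else 0) \<in> borel_measurable lebesgue"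
    using f S by (simp add: borel_measurable_if)
  ultimately have "(\<lambda>x. if x \<in> S then g x else 0) \<in> borel_measurable lebesgue"
    by (rule borel_measurable_AE[rotated])
  then show ?thesis using S by (simp add: borel_measurable_if)
qed

text \<open>Weighted Young inequality. The weight \<open>s\<close> stays free because fixing it
  would lose the sharp constant 1 in the triangle inequality for \<open>sd_norm\<close>.\<close>

lemma norm_add_sq_le:
  fixes u v :: "'a::real_inner" and s :: real
  assumes "s > 0"
  shows "(norm (u + v))\<^sup>2 \<le> (1 + s) * (norm u)\<^sup>2 + (1 + 1 / s) * (norm v)\<^sup>2"
proof -
  have "2 * (u \<bullet> v) \<le> s * (norm u)\<^sup>2 + (norm v)\<^sup>2 / s"
  proof -
    have "0 \<le> (norm (sqrt s *\<^sub>R u - (1 / sqrt s) *\<^sub>R v))\<^sup>2" by simp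
    also have "\<dots> = s * (norm u)\<^sup>2 + (norm v)\<^sup>2 / s - 2 * (u \<bullet> v)"
      using assms unfolding power2_norm_eq_inner
      by (simp add: inner_diff_left inner_diff_right inner_commute field_simps flip: power2_eq_square)
    finally show ?thesis by simp
  qed
  moreover have "(norm (u + v))\<^sup>2 = (norm u)\<^sup>2 + (norm v)\<^sup>2 + 2 * (u \<bullet> v)"
    by (simp add: power2_norm_eq_inner inner_add_left inner_add_right inner_commute)
  ultimately show ?thesis by (simp add: algebra_simps)
qed

text \<open>Minkowski's inequality by optimising over \<open>s\<close>: at s = sqrt y / sqrt x the
  right side becomes the square of sqrt x + sqrt y.\<close>

lemma sqrt_le_add_sqrt:
  fixes x y z :: real
  assumes x: "x \<ge> 0" and y: "y \<ge> 0" and z: "z \<ge> 0"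
    and le: "\<And>s. s > 0 \<Longrightarrow> z \<le> (1 + s) * x + (1 + 1 / s) * y"
  shows "sqrt z \<le> sqrt x + sqrt y"
proof (rule field_le_epsilon)
  fix e :: real assume e: "e > 0"
  \<comment> \<open>Shifting both roots by e/2 keeps the optimal weight q / p defined and positive
    when \<open>x\<close> or \<open>y\<close> is 0.\<close>
  define p q where "p = sqrt x + e / 2" and "q = sqrt y + e / 2"
  have pq: "p > 0" "q > 0" using e x y by (auto simp: p_def q_def add_nonneg_pos)
  have "x \<le> p\<^sup>2" "y \<le> q\<^sup>2"
    using e x y by (auto simp: p_def q_def power2_sum)
  then have "z \<le> (1 + q / p) * p\<^sup>2 + (1 + 1 / (q / p)) * q\<^sup>2"
    using le[of "q / p"] pq
    by (smt (verit) divide_pos_pos mult_left_mono)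
  also have "\<dots> = (p + q)\<^sup>2"
    using pq by (simp add: field_simps power2_eq_square)
  finally have "sqrt z \<le> p + q"
    using pq by (simp add: real_le_lsqrt z)
  then show "sqrt z \<le> sqrt x + sqrt y + e" by (simp add: p_def q_def)
qed

text \<open>On a bounded interval this takes the place of Cauchy-Schwarz: the integral of a norm is
  at most the length plus the integral of its square.\<close>

lemma le_one_add_sq: "r \<le> 1 + r\<^sup>2" for r :: real
proof -
  have "2 * r \<le> r\<^sup>2 + 1"
    using zero_le_power2[of "r - 1"] by (simp add: power2_diff)
  then show ?thesis using zero_le_power2[of r] by linarith
qed

lemma L2_fun_lincomb:
  fixes f g :: "real \<Rightarrow> real^'N"
  assumes "L2_fun a b f" "L2_fun a b g"
  shows "L2_fun a b (\<lambda>y. p *\<^sub>R f y + q *\<^sub>R g y)"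
proof -
  have f[measurable]: "f \<in> borel_measurable (lebesgue_on {a<..<b})"
    and g[measurable]: "g \<in> borel_measurable (lebesgue_on {a<..<b})"
    and i: "integrable (lebesgue_on {a<..<b}) (\<lambda>y. (norm (f y))\<^sup>2)"
      "integrable (lebesgue_on {a<..<b}) (\<lambda>y. (norm (g y))\<^sup>2)"
    using assms by (auto simp: L2_fun_def)
  have "integrable (lebesgue_on {a<..<b})
      (\<lambda>y. 2 * p\<^sup>2 * (norm (f y))\<^sup>2 + 2 * q\<^sup>2 * (norm (g y))\<^sup>2)"
    using i by simp
  then have "integrable (lebesgue_on {a<..<b}) (\<lambda>y. (norm (p *\<^sub>R f y + q *\<^sub>R g y))\<^sup>2)"
  proof (rule Bochner_Integration.integrable_bound)
    show "AE y in lebesgue_on {a<..<b}. norm ((norm (p *\<^sub>R f y + q *\<^sub>R g y))\<^sup>2)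
       \<le> norm (2 * p\<^sup>2 * (norm (f y))\<^sup>2 + 2 * q\<^sup>2 * (norm (g y))\<^sup>2)"
      using norm_add_sq_le[of 1 "p *\<^sub>R f y" "q *\<^sub>R g y" for y]
      by (intro AE_I2) (simp add: power_mult_distrib mult.assoc)
  qed measurable
  then show ?thesis by (auto simp: L2_fun_def)
qed

lemma L2_fun_AE_cong:
  assumes "L2_fun a b f" and ae: "AE y in lebesgue_on {a<..<b}. f y = g y"
  shows "L2_fun a b g"
proof -
  have m: "g \<in> borel_measurable (lebesgue_on {a<..<b})"
    using assms by (auto simp: L2_fun_def intro: borel_measurable_lebesgue_on_AE)
  have "integrable (lebesgue_on {a<..<b}) (\<lambda>y. (norm (g y))\<^sup>2)"
  proof (rule integrable_cong_AE_imp)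
    show "integrable (lebesgue_on {a<..<b}) (\<lambda>y. (norm (f y))\<^sup>2)"
      using assms by (simp add: L2_fun_def)
    show "AE y in lebesgue_on {a<..<b}. (norm (f y))\<^sup>2 = (norm (g y))\<^sup>2"
      using ae by eventually_elim simp
  qed (use m in measurable)
  then show ?thesis using m by (simp add: L2_fun_def)
qed

lemma L2_fun_integrable:
  assumes "L2_fun a b f"
  shows "integrable (lebesgue_on {a<..<b}) f"
proof (rule Bochner_Integration.integrable_bound)
  interpret finite_measure "lebesgue_on {a<..<b}"
    by (rule finite_measure_lebesgue_on) simp
  show "integrable (lebesgue_on {a<..<b}) (\<lambda>y. 1 + (norm (f y))\<^sup>2)"
    using assms by (auto simp: L2_fun_def)
  show "AE y in lebesgue_on {a<..<b}. norm (f y) \<le> norm (1 + (norm (f y))\<^sup>2)"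
    using le_one_add_sq by (auto simp: abs_of_nonneg)
qed (use assms in \<open>simp add: L2_fun_def\<close>)

lemma H1_funD:
  assumes "H1_fun a b f"
  shows "L2_fun a b f" and "AE y in lebesgue_on {a<..<b}. f differentiable (at y)"
    and "L2_fun a b (\<lambda>y. vector_derivative f (at y))"
    and "y \<in> {a..b} \<Longrightarrow> f y = f a + integral {a..y} (\<lambda>t. vector_derivative f (at t))"
  using assms unfolding H1_fun_def by blast+

lemma AE_vector_derivative_lincomb:
  assumes "H1_fun a b f" "H1_fun a b g"
  shows "AE y in lebesgue_on {a<..<b}.
    ((\<lambda>y. p *\<^sub>R f y + q *\<^sub>R g y) has_vector_derivative
       p *\<^sub>R vector_derivative f (at y) + q *\<^sub>R vector_derivative g (at y)) (at y)"
proof -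
  have "AE y in lebesgue_on {a<..<b}. f differentiable (at y)"
    "AE y in lebesgue_on {a<..<b}. g differentiable (at y)"
    using assms by (auto dest: H1_funD(2))
  then show ?thesis
    by eventually_elim (auto intro!: derivative_eq_intros simp: vector_derivative_works)
qed

lemma H1_fun_deriv_integrable:
  assumes "H1_fun a b f" "y \<in> {a..b}"
  shows "(\<lambda>t. vector_derivative f (at t)) integrable_on {a..y}"
proof -
  have "integrable (lebesgue_on {a<..<b}) (\<lambda>t. vector_derivative f (at t))"
    using assms(1) by (intro L2_fun_integrable H1_funD(3))
  then have "(\<lambda>t. vector_derivative f (at t)) integrable_on {a<..<b}"
    by (rule integrable_on_lebesgue_on) simp
  then have "(\<lambda>t. vector_derivative f (at t)) integrable_on {a..b}"
    using integrable_on_open_interval_real by blast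
  then show ?thesis
    using assms by (auto elim: integrable_on_subinterval)
qed

lemma H1_fun_lincomb:
  fixes f g :: "real \<Rightarrow> real^'N"
  assumes f: "H1_fun a b f" and g: "H1_fun a b g"
  shows "H1_fun a b (\<lambda>y. p *\<^sub>R f y + q *\<^sub>R g y)"
proof -
  let ?h = "\<lambda>y. p *\<^sub>R f y + q *\<^sub>R g y"
  let ?h' = "\<lambda>y. p *\<^sub>R vector_derivative f (at y) + q *\<^sub>R vector_derivative g (at y)"
  have ae: "AE y in lebesgue_on {a<..<b}. (?h has_vector_derivative ?h' y) (at y)"
    using AE_vector_derivative_lincomb[OF f g] .
  then have ae': "AE y in lebesgue_on {a<..<b}. ?h' y = vector_derivative ?h (at y)"
    by eventually_elim (simp add: vector_derivative_at)
  have "AE y in lebesgue. y \<in> {a<..<b} \<longrightarrow> ?h' y = vector_derivative ?h (at y)"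
    using ae' by (simp add: AE_restrict_space_iff)
  then obtain N where N: "N \<in> null_sets lebesgue"
    "\<And>y. y \<notin> N \<Longrightarrow> y \<in> {a<..<b} \<longrightarrow> ?h' y = vector_derivative ?h (at y)"
    unfolding completion.AE_iff_null_sets by auto
  \<comment> \<open>The endpoints join the null set because the almost everywhere statement concerns
    the open interval, while the integrals run over closed ones.\<close>
  have neg: "negligible (N \<union> {a, b})"
    using N(1) by (simp add: negligible_iff_null_sets[symmetric])
  have "?h y = ?h a + integral {a..y} (\<lambda>t. vector_derivative ?h (at t))" if y: "y \<in> {a..b}" for y
  proof -
    have "integral {a..y} (\<lambda>t. vector_derivative ?h (at t)) = integral {a..y} ?h'"
      using neg by (rule integral_spike) (use N(2) y in auto)
    also have "\<dots> = p *\<^sub>R integral {a..y} (\<lambda>t. vector_derivative f (at t))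
        + q *\<^sub>R integral {a..y} (\<lambda>t. vector_derivative g (at t))"
      using H1_fun_deriv_integrable[OF f y] H1_fun_deriv_integrable[OF g y]
      by (simp add: integral_add integrable_cmul)
    moreover have "f y = f a + integral {a..y} (\<lambda>t. vector_derivative f (at t))"
      "g y = g a + integral {a..y} (\<lambda>t. vector_derivative g (at t))"
      using f g y unfolding H1_fun_def by blast+
    ultimately show ?thesis
      by (simp only: scaleR_add_right) (simp only: ac_simps)
  qed
  moreover have "L2_fun a b ?h"
    using f g by (intro L2_fun_lincomb H1_funD(1))
  moreover have "L2_fun a b (\<lambda>y. vector_derivative ?h (at y))"
  proof (rule L2_fun_AE_cong[OF _ ae'])
    show "L2_fun a b ?h'"
      using f g by (intro L2_fun_lincomb H1_funD(3))
  qed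
  moreover have "AE y in lebesgue_on {a<..<b}. ?h differentiable (at y)"
    using ae by eventually_elim (rule differentiableI_vector)
  ultimately show ?thesis unfolding H1_fun_def by blast
qed

text \<open>Sobolev embedding of H^1 into the bounded functions on an interval, with crude
  constants. Any increment from \<open>a\<close> is at most the integral of the norm of the
  derivative, hence at most b - a plus the integral of its square.\<close>

lemma H1_fun_sup_bound:
  fixes f :: "real \<Rightarrow> real^'N"
  assumes f: "H1_fun a b f" and ab: "a < b" and y: "y \<in> {a..b}"
  shows "norm (f y) \<le> 2 * (b - a) + 1 + (LINT t|lebesgue_on {a<..<b}. (norm (f t))\<^sup>2) / (b - a)
    + 2 * (LINT t|lebesgue_on {a<..<b}. (norm (vector_derivative f (at t)))\<^sup>2)"
    (is "_ \<le> _ + ?F / _ + 2 * ?G")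
proof -
  let ?f' = "\<lambda>t. vector_derivative f (at t)"
  interpret finite_measure "lebesgue_on {a<..<b}"
    by (rule finite_measure_lebesgue_on) simp
  have meas: "measure (lebesgue_on {a<..<b}) {a<..<b} = b - a"
    using ab by (simp add: measure_restrict_space)
  have L: "L2_fun a b f" "L2_fun a b ?f'" using f by (auto dest: H1_funD)
  have i: "integrable (lebesgue_on {a<..<b}) (\<lambda>t. 1 + (norm (?f' t))\<^sup>2)"
    "integrable (lebesgue_on {a<..<b}) (\<lambda>t. 1 + (norm (f t))\<^sup>2)"
    using L by (auto simp: L2_fun_def)
  have hi: "((\<lambda>t. 1 + (norm (?f' t))\<^sup>2) has_integral (b - a + ?G)) {a..b}"
  proof -
    have "((\<lambda>t. 1 + (norm (?f' t))\<^sup>2) has_integral (b - a + ?G)) {a<..<b}"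
      using has_integral_integral_lebesgue_on[OF i(1)] L by (simp add: L2_fun_def meas)
    then show ?thesis using has_integral_open_interval[of _ _ a b] by (metis box_real(1) cbox_interval)
  qed
  have incr: "norm (f x - f a) \<le> b - a + ?G" if x: "x \<in> {a..b}" for x
  proof -
    have "norm (f x - f a) = norm (integral {a..x} ?f')"
      using f x unfolding H1_fun_def by (metis add_diff_cancel_left')
    also have "\<dots> \<le> integral {a..x} (\<lambda>t. 1 + (norm (?f' t))\<^sup>2)"
    proof (rule Henstock_Kurzweil_Integration.integral_norm_bound_integral)
      show "(\<lambda>t. 1 + (norm (?f' t))\<^sup>2) integrable_on {a..x}"
        using hi x by (auto simp: has_integral_iff intro: integrable_on_subinterval)
    qed (use H1_fun_deriv_integrable[OF f x] le_one_add_sq in auto)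
    also have "\<dots> \<le> integral {a..b} (\<lambda>t. 1 + (norm (?f' t))\<^sup>2)"
      using hi x by (intro integral_subset_le) (auto simp: has_integral_iff intro: integrable_on_subinterval)
    also have "\<dots> = b - a + ?G" using hi by (rule integral_unique)
    finally show ?thesis .
  qed
  \<comment> \<open>The values at \<open>y\<close> and at an arbitrary \<open>t\<close> are compared
    through the base point \<open>a\<close>, which costs two increments. Averaging over
    \<open>t\<close> then replaces f(t) by an integral.\<close>
  have "norm (f y) \<le> 1 + (norm (f t))\<^sup>2 + 2 * (b - a + ?G)" if "t \<in> {a<..<b}" for t
  proof -
    have "norm (f y) \<le> norm (f t) + norm (f y - f a) + norm (f t - f a)"
      by (smt (verit) norm_triangle_ineq3 norm_minus_commute norm_triangle_ineq2)
    with incr[OF y] incr[of t] le_one_add_sq[of "norm (f t)"] that show ?thesis by auto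
  qed
  then have "(LINT t|lebesgue_on {a<..<b}. norm (f y))
      \<le> (LINT t|lebesgue_on {a<..<b}. 1 + (norm (f t))\<^sup>2 + 2 * (b - a + ?G))"
    using i(2) by (intro integral_mono) auto
  also have "\<dots> = (b - a) + ?F + (b - a) * (2 * (b - a + ?G))"
    using L i by (simp add: L2_fun_def meas)
  finally have "(b - a) * norm (f y) \<le> (b - a) + ?F + (b - a) * (2 * (b - a + ?G))"
    by (simp add: meas)
  then show ?thesis using ab by (simp add: field_simps)
qed

section \<open>The semi-discrete norm\<close>

text \<open>One operation covers sums, differences, negation (p = -1, q = 0) and scaling, so closure
  of the space, traces and the norm inequality are each proved once.\<close>

definition lincomb :: "real \<Rightarrow> ('n::finite, 'N::finite) sdfun \<Rightarrow> real \<Rightarrow> ('n, 'N) sdfun \<Rightarrow> ('n, 'N) sdfun" where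
  "lincomb p Q q V = (\<lambda>J y. p *\<^sub>R Q J y + q *\<^sub>R V J y)"

definition sd_density :: "real \<Rightarrow> nat \<Rightarrow> 'n \<Rightarrow> ('n::finite, 'N::finite) sdfun \<Rightarrow>
    ('n \<Rightarrow> nat) \<Rightarrow> real \<Rightarrow> real" where
  "sd_density A m k Q J y = (norm (Q J y))\<^sup>2 + (norm (dx A m k Q J y))\<^sup>2 + (norm (dy Q J y))\<^sup>2"

lemma sd_norm_eq: "sd_norm A a b m Q =
  sqrt (\<Sum>J\<in>interior_ix m. \<Sum>k\<in>UNIV. LINT y|lebesgue_on {a<..<b}. sd_density A m k Q J y)"
  by (simp add: sd_norm_def sd_density_def)

lemma sd_density_nonneg: "0 \<le> sd_density A m k Q J y"
  by (simp add: sd_density_def)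

lemma sd_norm_nonneg: "0 \<le> sd_norm A a b m Q"
  by (simp add: sd_norm_eq sum_nonneg integral_nonneg_AE sd_density_nonneg)

lemma sd_norm_sq: "(sd_norm A a b m Q)\<^sup>2 =
  (\<Sum>J\<in>interior_ix m. \<Sum>k\<in>UNIV. LINT y|lebesgue_on {a<..<b}. sd_density A m k Q J y)"
  by (simp add: sd_norm_eq sum_nonneg integral_nonneg_AE sd_density_nonneg)

lemma dx_lincomb: "dx A m k (lincomb p Q q V) J y = p *\<^sub>R dx A m k Q J y + q *\<^sub>R dx A m k V J y"
  by (simp add: dx_def lincomb_def algebra_simps)

lemma H1h_lincomb:
  assumes "Q \<in> H1h A a b m" "V \<in> H1h A a b m"
  shows "lincomb p Q q V \<in> H1h A a b m"
proof -
  have "H1_fun a b (lincomb p Q q V J)" if "J \<in> interior_ix m" for J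
    unfolding lincomb_def using assms that by (intro H1_fun_lincomb) (simp_all add: H1h_def)
  moreover have "L2_fun a b (dx A m k (lincomb p Q q V) J)" if "J \<in> interior_ix m" for J k
    unfolding dx_lincomb[abs_def] using assms that by (simp add: H1h_def L2_fun_lincomb)
  ultimately show ?thesis by (simp add: H1h_def)
qed

lemma has_trace_lincomb:
  assumes "has_trace a b m Q P" "has_trace a b m V P'"
  shows "has_trace a b m (lincomb p Q q V) (lincomb p P q P')"
  using assms by (fastforce simp: has_trace_def lincomb_def)

lemma AE_dy_lincomb:
  assumes "Q \<in> H1h A a b m" "V \<in> H1h A a b m" "J \<in> interior_ix m"
  shows "AE y in lebesgue_on {a<..<b}. dy (lincomb p Q q V) J y = p *\<^sub>R dy Q J y + q *\<^sub>R dy V J y"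
proof -
  have "H1_fun a b (Q J)" "H1_fun a b (V J)" using assms by (auto simp: H1h_def)
  from AE_vector_derivative_lincomb[OF this, of p q] show ?thesis
    by eventually_elim (simp add: dy_def lincomb_def vector_derivative_at)
qed

lemma sd_density_integrable:
  assumes "Q \<in> H1h A a b m" "J \<in> interior_ix m"
  shows "integrable (lebesgue_on {a<..<b}) (sd_density A m k Q J)"
proof -
  have "H1_fun a b (Q J)" "L2_fun a b (dx A m k Q J)" using assms by (auto simp: H1h_def)
  then have "L2_fun a b (Q J)" "L2_fun a b (dy Q J)" "L2_fun a b (dx A m k Q J)"
    unfolding dy_def[abs_def] by (simp_all add: H1_funD(1,3))
  then show ?thesis
    unfolding sd_density_def[abs_def] by (simp add: L2_fun_def)
qed

text \<open>Triangle inequality and homogeneity in one statement. The weighted Young inequality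
  holds pointwise for each \<open>s\<close>, survives integration and summation, and is optimised
  only at the end.\<close>

lemma sd_norm_lincomb_le:
  fixes Q V :: "('n::finite, 'N::finite) sdfun"
  assumes Q: "Q \<in> H1h A a b m" and V: "V \<in> H1h A a b m"
  shows "sd_norm A a b m (lincomb p Q q V) \<le> \<bar>p\<bar> * sd_norm A a b m Q + \<bar>q\<bar> * sd_norm A a b m V"
proof -
  let ?M = "lebesgue_on {a<..<b}"
  let ?I = "\<lambda>W. \<Sum>J\<in>interior_ix m. \<Sum>k\<in>UNIV. LINT y|?M. sd_density A m k W J y"
  have I0: "?I W \<ge> 0" for W :: "('n, 'N) sdfun"
    by (simp add: sum_nonneg integral_nonneg_AE sd_density_nonneg)
  have "sqrt (?I (lincomb p Q q V)) \<le> sqrt (p\<^sup>2 * ?I Q) + sqrt (q\<^sup>2 * ?I V)"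
  proof (rule sqrt_le_add_sqrt)
    fix s :: real assume s: "s > 0"
    have "(LINT y|?M. sd_density A m k (lincomb p Q q V) J y)
        \<le> (LINT y|?M. (1 + s) * p\<^sup>2 * sd_density A m k Q J y + (1 + 1 / s) * q\<^sup>2 * sd_density A m k V J y)"
      if J: "J \<in> interior_ix m" for J k
    proof (rule integral_mono_AE')
      show "integrable ?M (\<lambda>y. (1 + s) * p\<^sup>2 * sd_density A m k Q J y
          + (1 + 1 / s) * q\<^sup>2 * sd_density A m k V J y)"
        using Q V J by (intro Bochner_Integration.integrable_add Bochner_Integration.integrable_mult_right sd_density_integrable)
      show "AE y in ?M. 0 \<le> (1 + s) * p\<^sup>2 * sd_density A m k Q J y
          + (1 + 1 / s) * q\<^sup>2 * sd_density A m k V J y"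
        using s by (intro AE_I2) (simp add: sd_density_nonneg)
      have sq: "(norm (p *\<^sub>R u + q *\<^sub>R v))\<^sup>2 \<le> (1 + s) * (p\<^sup>2 * (norm u)\<^sup>2) + (1 + 1 / s) * (q\<^sup>2 * (norm v)\<^sup>2)"
        for u v :: "real^'N"
        using norm_add_sq_le[OF s, of "p *\<^sub>R u" "q *\<^sub>R v"] by (simp add: power_mult_distrib)
      show "AE y in ?M. sd_density A m k (lincomb p Q q V) J y
          \<le> (1 + s) * p\<^sup>2 * sd_density A m k Q J y + (1 + 1 / s) * q\<^sup>2 * sd_density A m k V J y"
        using AE_dy_lincomb[OF Q V J, of p q]
      proof eventually_elim
        case (elim y)
        show ?case
          using sq[of "Q J y" "V J y"] sq[of "dx A m k Q J y" "dx A m k V J y"] sq[of "dy Q J y" "dy V J y"]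
          unfolding sd_density_def dx_lincomb elim by (simp add: lincomb_def algebra_simps)
      qed
    qed
    also have "(LINT y|?M. (1 + s) * p\<^sup>2 * sd_density A m k Q J y + (1 + 1 / s) * q\<^sup>2 * sd_density A m k V J y)
        = (1 + s) * p\<^sup>2 * (LINT y|?M. sd_density A m k Q J y) + (1 + 1 / s) * q\<^sup>2 * (LINT y|?M. sd_density A m k V J y)"
      if "J \<in> interior_ix m" for J k
      using sd_density_integrable[OF Q that, of k] sd_density_integrable[OF V that, of k] by simp
    finally have "?I (lincomb p Q q V) \<le> (\<Sum>J\<in>interior_ix m. \<Sum>k\<in>UNIV.
        (1 + s) * p\<^sup>2 * (LINT y|?M. sd_density A m k Q J y) + (1 + 1 / s) * q\<^sup>2 * (LINT y|?M. sd_density A m k V J y))"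
      by (intro sum_mono)
    then show "?I (lincomb p Q q V) \<le> (1 + s) * (p\<^sup>2 * ?I Q) + (1 + 1 / s) * (q\<^sup>2 * ?I V)"
      by (simp add: sum.distrib sum_distrib_left mult.assoc)
  qed (use I0 in auto)
  then show ?thesis by (simp add: sd_norm_eq real_sqrt_mult)
qed

lemma finite_interior_ix: "finite (interior_ix m :: ('n::finite \<Rightarrow> nat) set)"
proof -
  have "interior_ix m \<subseteq> (UNIV :: 'n set) \<rightarrow>\<^sub>E {..m}"
    by (fastforce simp: interior_ix_def PiE_iff intro: order_trans)
  then show ?thesis by (rule finite_subset) (intro finite_PiE, auto)
qed

lemma lincomb_simps:
  "lincomb 1 Q 1 V = Q + V" "lincomb 1 Q (-1) V = Q - V"
  by (auto simp: lincomb_def fun_eq_iff)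

text \<open>Supplies the radius of the ball in R^N on which the nonlinearity has to be Lipschitz;
  the bound is uniform in the node and in the grid.\<close>

lemma H1h_sup_bound:
  fixes Q :: "('n::finite, 'N::finite) sdfun"
  assumes Q: "Q \<in> H1h A a b m" and J: "J \<in> interior_ix m" and ab: "a < b" and y: "y \<in> {a..b}"
    and R: "sd_norm A a b m Q \<le> R"
  shows "norm (Q J y) \<le> 2 * (b - a) + 1 + R\<^sup>2 / (b - a) + 2 * R\<^sup>2"
proof -
  let ?M = "lebesgue_on {a<..<b}"
  have H: "H1_fun a b (Q J)" using Q J by (auto simp: H1h_def)
  \<comment> \<open>Any direction will do: the summand of every \<open>k\<close> contains the full
    squares of Q and of its \<open>y\<close>-derivative.\<close>
  obtain k :: 'n where True by simp
  have "(LINT y|?M. sd_density A m k Q J y) \<le> (\<Sum>k\<in>UNIV. LINT y|?M. sd_density A m k Q J y)"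
    by (rule member_le_sum) (auto intro: integral_nonneg_AE sd_density_nonneg)
  also have "\<dots> \<le> (\<Sum>J\<in>interior_ix m. \<Sum>k\<in>UNIV. LINT y|?M. sd_density A m k Q J y)"
    using J finite_interior_ix
    by (intro member_le_sum[of J _ "\<lambda>J. \<Sum>k\<in>UNIV. LINT y|?M. sd_density A m k Q J y"])
      (auto intro!: sum_nonneg integral_nonneg_AE sd_density_nonneg)
  also have "\<dots> \<le> R\<^sup>2"
    unfolding sd_norm_sq[symmetric] using R sd_norm_nonneg by (intro power_mono)
  finally have dens: "(LINT y|?M. sd_density A m k Q J y) \<le> R\<^sup>2" .
  have "(LINT y|?M. (norm (Q J y))\<^sup>2) \<le> (LINT y|?M. sd_density A m k Q J y)"
    using sd_density_integrable[OF Q J, of k]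
    by (rule integral_mono_AE') (simp_all add: sd_density_nonneg, simp add: sd_density_def)
  moreover have "(LINT y|?M. (norm (vector_derivative (Q J) (at y)))\<^sup>2) \<le> (LINT y|?M. sd_density A m k Q J y)"
    using sd_density_integrable[OF Q J, of k]
    by (rule integral_mono_AE') (simp_all add: sd_density_nonneg, simp add: sd_density_def dy_def)
  ultimately have "(LINT y|?M. (norm (Q J y))\<^sup>2) / (b - a) \<le> R\<^sup>2 / (b - a)"
    "2 * (LINT y|?M. (norm (vector_derivative (Q J) (at y)))\<^sup>2) \<le> 2 * R\<^sup>2"
    using dens ab by (auto intro: divide_right_mono)
  with H1_fun_sup_bound[OF H ab y] show ?thesis by linarith
qed

section \<open>Distance of a competitor to the minimizer\<close>

text \<open>\<open>lincomb p Q 0 Q\<close> is the multiple p Q.\<close>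

lemma sd_norm_scale_le:
  assumes "Q \<in> H1h A a b m"
  shows "sd_norm A a b m (lincomb p Q 0 Q) \<le> \<bar>p\<bar> * sd_norm A a b m Q"
  using sd_norm_lincomb_le[OF assms assms, of p 0] by simp

lemma H1h_diff: "Q \<in> H1h A a b m \<Longrightarrow> V \<in> H1h A a b m \<Longrightarrow> Q - V \<in> H1h A a b m"
  by (metis H1h_lincomb lincomb_simps(2))

lemma H1h_add: "Q \<in> H1h A a b m \<Longrightarrow> V \<in> H1h A a b m \<Longrightarrow> Q + V \<in> H1h A a b m"
  by (metis H1h_lincomb lincomb_simps(1))

lemma sd_norm_add_le:
  assumes "Q \<in> H1h A a b m" "V \<in> H1h A a b m"
  shows "sd_norm A a b m (Q + V) \<le> sd_norm A a b m Q + sd_norm A a b m V"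
  using sd_norm_lincomb_le[OF assms, of 1 1] by (simp add: lincomb_simps)

lemma sd_norm_minus_commute:
  assumes "Q \<in> H1h A a b m" "V \<in> H1h A a b m"
  shows "sd_norm A a b m (Q - V) = sd_norm A a b m (V - Q)"
proof (rule antisym)
  have eq: "lincomb (-1) W 0 W = - W" for W :: "('a::finite, 'b::finite) sdfun"
    by (simp add: lincomb_def fun_eq_iff)
  show "sd_norm A a b m (Q - V) \<le> sd_norm A a b m (V - Q)"
    using sd_norm_scale_le[OF H1h_diff[OF assms(2,1)], of "-1"] by (simp add: eq)
  show "sd_norm A a b m (V - Q) \<le> sd_norm A a b m (Q - V)"
    using sd_norm_scale_le[OF H1h_diff[OF assms(1,2)], of "-1"] by (simp add: eq)
qed

section \<open>Admissible sets and convexity at the midpoint\<close>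

lemma Bset_subset_Bclosure: "Bset A a b m \<rho> P \<subseteq> Bclosure A a b m \<rho> P"
proof
  fix W :: "('a::finite, 'b::finite) sdfun" assume W: "W \<in> Bset A a b m \<rho> P"
  then have H: "W \<in> H1h A a b m" by (simp add: Bset_def)
  have "W - W = lincomb 0 W 0 W" by (simp add: lincomb_def fun_eq_iff)
  then have "sd_norm A a b m (W - W) = 0"
    using sd_norm_scale_le[OF H, of 0] sd_norm_nonneg[of A a b m "W - W"] by simp
  then show "W \<in> Bclosure A a b m \<rho> P"
    using W by (auto simp: Bclosure_def Bset_def)
qed

lemma Bclosure_mono:
  assumes "\<rho> \<le> \<rho>'"
  shows "Bclosure A a b m \<rho> P \<subseteq> Bclosure A a b m \<rho>' P"
proof -
  have "Bset A a b m \<rho> P \<subseteq> Bset A a b m \<rho>' P" using assms by (auto simp: Bset_def)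
  then show ?thesis unfolding Bclosure_def by blast
qed

text \<open>If \<open>V\<close> in the open ball approximates \<open>W\<close>, then the midpoint of
  \<open>V\<close> and \<open>Q\<close> lies in the open ball by the triangle inequality and
  approximates the midpoint of \<open>W\<close> and \<open>Q\<close> twice as well. This makes the
  midpoint admissible in the minimization.\<close>

lemma Bclosure_midpoint:
  fixes W Q P :: "('n::finite, 'N::finite) sdfun"
  assumes W: "W \<in> Bclosure A a b m \<rho> P" and Q: "Q \<in> Bset A a b m \<rho> P"
  shows "lincomb (1/2) W (1/2) Q \<in> Bclosure A a b m \<rho> P"
proof -
  have trace: "has_trace a b m (lincomb (1/2) V (1/2) Q) P"
    if "has_trace a b m V P" for V
  proof -
    have "lincomb (1/2) P (1/2) P = P"
      by (simp add: lincomb_def fun_eq_iff flip: scaleR_add_left)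
    then show ?thesis using that Q has_trace_lincomb[of a b m V P Q P "1/2" "1/2"] by (simp add: Bset_def)
  qed
  have "\<exists>V\<in>Bset A a b m \<rho> P. sd_norm A a b m (V - lincomb (1/2) W (1/2) Q) < e" if e: "e > 0" for e
  proof -
    obtain V where V: "V \<in> Bset A a b m \<rho> P" "sd_norm A a b m (V - W) < e"
      using W e by (auto simp: Bclosure_def)
    have "lincomb (1/2) V (1/2) Q - lincomb (1/2) W (1/2) Q = lincomb (1/2) (V - W) 0 (V - W)"
      by (simp add: lincomb_def fun_eq_iff algebra_simps)
    then have "sd_norm A a b m (lincomb (1/2) V (1/2) Q - lincomb (1/2) W (1/2) Q) \<le> \<bar>1/2\<bar> * sd_norm A a b m (V - W)"
      using V W sd_norm_scale_le[of "V - W" A a b m "1/2"] by (simp add: H1h_diff Bset_def Bclosure_def)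
    moreover have "sd_norm A a b m (lincomb (1/2) V (1/2) Q) < \<rho>"
      using V(1) Q sd_norm_lincomb_le[of V A a b m Q "1/2" "1/2"] by (simp add: Bset_def)
    ultimately show ?thesis
      using V Q trace[of V] sd_norm_nonneg[of A a b m "V - W"]
      by (intro bexI[of _ "lincomb (1/2) V (1/2) Q"]) (auto simp: Bset_def H1h_lincomb)
  qed
  then show ?thesis using W Q trace[of W] by (auto simp: Bclosure_def Bset_def H1h_lincomb)
qed

text \<open>The two increments from a midpoint are opposite, so oddness is the form of linearity
  that cancels the gradient terms. It goes through almost everywhere equality of the integrands,
  since \<open>dy\<close> of -V is known only almost everywhere.\<close>

lemma sd_inner_minus_right:
  fixes G V :: "('n::finite, 'N::finite) sdfun"
  assumes G: "G \<in> H1h A a b m" and V: "V \<in> H1h A a b m"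
  shows "sd_inner A a b m G (- V) = - sd_inner A a b m G V"
proof -
  let ?M = "lebesgue_on {a<..<b}"
  have mV: "- V = lincomb (-1) V 0 V" by (simp add: lincomb_def fun_eq_iff)
  have H: "- V \<in> H1h A a b m" using H1h_lincomb[OF V V] by (simp add: mV)
  have meas: "W J \<in> borel_measurable ?M" "dx A m k W J \<in> borel_measurable ?M" "dy W J \<in> borel_measurable ?M"
    if "W \<in> H1h A a b m" "J \<in> interior_ix m" for W :: "('n, 'N) sdfun" and J k
  proof -
    have "H1_fun a b (W J)" "L2_fun a b (dx A m k W J)" using that by (auto simp: H1h_def)
    then have "L2_fun a b (W J)" "L2_fun a b (dy W J)" "L2_fun a b (dx A m k W J)"
      unfolding dy_def[abs_def] by (simp_all add: H1_funD(1,3))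
    then show "W J \<in> borel_measurable ?M" "dx A m k W J \<in> borel_measurable ?M" "dy W J \<in> borel_measurable ?M"
      by (simp_all add: L2_fun_def)
  qed
  have "(LINT y|?M. G J y \<bullet> (- V) J y + dx A m k G J y \<bullet> dx A m k (- V) J y + dy G J y \<bullet> dy (- V) J y)
      = - (LINT y|?M. G J y \<bullet> V J y + dx A m k G J y \<bullet> dx A m k V J y + dy G J y \<bullet> dy V J y)"
    (is "?l = - ?r") if J: "J \<in> interior_ix m" for J k
  proof -
    have "?l = (LINT y|?M. - (G J y \<bullet> V J y + dx A m k G J y \<bullet> dx A m k V J y + dy G J y \<bullet> dy V J y))"
    proof (rule integral_cong_AE)
      show "AE y in ?M. G J y \<bullet> (- V) J y + dx A m k G J y \<bullet> dx A m k (- V) J y + dy G J y \<bullet> dy (- V) J y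
         = - (G J y \<bullet> V J y + dx A m k G J y \<bullet> dx A m k V J y + dy G J y \<bullet> dy V J y)"
        using AE_dy_lincomb[OF V V J, of "-1" 0] unfolding mV[symmetric]
        by eventually_elim (simp add: mV dx_lincomb, simp add: lincomb_def)
    qed (intro borel_measurable_add borel_measurable_inner borel_measurable_uminus meas G V H J)+
    also have "\<dots> = - ?r" by (rule Bochner_Integration.integral_minus)
    finally show ?thesis .
  qed
  then show ?thesis by (simp add: sd_inner_def sum_negf)
qed

text \<open>
  Strong convexity is applied at the midpoint of the minimizer and the competitor: the two gradient
  terms cancel, so that no variational inequality for the minimizer is needed.
\<close>

lemma minimizer_distance_le:
  fixes P Q Wmin :: "('n::finite, 'N::finite) sdfun"
  assumes conv: "is_lambda1 A d a b h0 mu K TYPE('N) (2 * R) lam c" and "R > 0"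
    and m: "1 < m" "step A m \<ge> h0"
    and min: "is_arg_min (Jfun A d a b m mu K lam) (\<lambda>W. W \<in> Bclosure A a b m R P) Wmin"
    and Q: "Q \<in> Bset A a b m R P"
  shows "c * exp (2 * lam * a) * (sd_norm A a b m (Q - Wmin))\<^sup>2 \<le> 2 * Jfun A d a b m mu K lam Q"
proof -
  let ?J = "Jfun A d a b m mu K lam" and ?N = "sd_norm A a b m"
  let ?c = "c * exp (2 * lam * a)"
  define V where "V = lincomb (1/2) Wmin (1/2) Q"
  have c: "?c > 0" using conv by (simp add: is_lambda1_def)
  have Wmin: "Wmin \<in> Bclosure A a b m R P" using min by (simp add: is_arg_min_def)
  have V: "V \<in> Bclosure A a b m R P" unfolding V_def using Wmin Q by (rule Bclosure_midpoint)
  have le: "?J Wmin \<le> ?J V" using min V by (auto simp: is_arg_min_linorder)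
  have sub: "Bclosure A a b m R P \<subseteq> Bclosure A a b m (2 * R) P"
    using \<open>R > 0\<close> by (intro Bclosure_mono) simp
  have mem: "Wmin \<in> Bclosure A a b m (2 * R) P" "V \<in> Bclosure A a b m (2 * R) P"
      "Q \<in> Bclosure A a b m (2 * R) P"
    using Wmin V Q sub Bset_subset_Bclosure[of A a b m R P] by auto
  obtain G where G: "has_frechet_gradient A a b m ?J V G"
    and ineq: "\<And>W. W \<in> Bclosure A a b m (2 * R) P \<Longrightarrow>
      ?J W - ?J V - sd_inner A a b m G (W - V) \<ge> ?c * (?N (W - V))\<^sup>2"
    using conv m mem(2) unfolding is_lambda1_def by (meson order_refl)
  have H: "G \<in> H1h A a b m" "Q \<in> H1h A a b m" "Wmin \<in> H1h A a b m" "V \<in> H1h A a b m"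
    using G Q Wmin V by (auto simp: has_frechet_gradient_def H10h_def Bset_def Bclosure_def)
  have opp: "Wmin - V = - (Q - V)"
    by (simp add: V_def lincomb_def fun_eq_iff algebra_simps flip: scaleR_add_left)
  \<comment> \<open>The midpoint halves the distance; squaring is the source of the factor
    4.\<close>
  have 1: "?N (Q - Wmin) \<le> 2 * ?N (Q - V)"
  proof -
    have "Q - Wmin = lincomb 2 (Q - V) 0 (Q - V)"
      by (simp add: V_def lincomb_def fun_eq_iff algebra_simps scaleR_2)
    then show ?thesis using sd_norm_scale_le[of "Q - V" A a b m 2] H by (simp add: H1h_diff)
  qed
  have 2: "?N (Wmin - V) = ?N (Q - V)"
    unfolding opp using H by (metis minus_diff_eq sd_norm_minus_commute)
  have "(?N (Q - Wmin))\<^sup>2 \<le> 4 * (?N (Q - V))\<^sup>2"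
    using power_mono[OF 1 sd_norm_nonneg, of 2] by (simp add: power_mult_distrib)
  then have "?c * (?N (Q - Wmin))\<^sup>2 \<le> ?c * (4 * (?N (Q - V))\<^sup>2)"
    using c by (intro mult_left_mono) auto
  then have 3: "?c * (?N (Q - Wmin))\<^sup>2 \<le> 4 * (?c * (?N (Q - V))\<^sup>2)" by (simp only: ac_simps)
  have "?J Wmin \<ge> 0" by (simp add: Jfun_def)
  moreover have "sd_inner A a b m G (Wmin - V) = - sd_inner A a b m G (Q - V)"
    unfolding opp using H by (intro sd_inner_minus_right H1h_diff)
  \<comment> \<open>Adding the two convexity inequalities at \<open>V\<close> gives J(Q) + J(Wmin) -
    2 J(V) \<ge> 2 c' N^2, where c' is the convexity constant with its exponential and N = ?N (Q -
    V). With 0 \<le> J(Wmin) \<le> J(V) this yields J(Q) \<ge> 2 c' N^2, and fact \<open>3\<close>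
    converts N into the distance from Q to \<open>Wmin\<close>.\<close>
  ultimately show ?thesis
    using ineq[OF mem(3)] ineq[OF mem(1)] le 3 unfolding 2 by (smt (verit))
qed

section \<open>Bounds for the basis and the matrices\<close>

text \<open>Strong induction, because each function is built from all earlier ones. Division by the
  normalising constant preserves C^1 whatever its value, division by 0 giving the zero
  function.\<close>

lemma Psi_C1:
  "(\<forall>t. (Psi d r has_real_derivative deriv (Psi d r) t) (at t)) \<and> continuous_on UNIV (deriv (Psi d r))"
proof (induction r rule: less_induct)
  case (less r)
  define k where "k s = L2_ip d (\<lambda>\<beta>. \<beta> ^ r * exp \<beta>) (Psi d s)" for s
  define u where "u = (\<lambda>\<alpha>. \<alpha> ^ r * exp \<alpha> - (\<Sum>s<r. k s * Psi d s \<alpha>))"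
  define D where "D t = (real r * t ^ (r - 1) * exp t + t ^ r * exp t - (\<Sum>s<r. k s * deriv (Psi d s) t))
    / sqrt (L2_ip d u u)" for t
  have eq: "Psi d r = (\<lambda>\<alpha>. u \<alpha> / sqrt (L2_ip d u u))"
    by (subst Psi.simps) (simp add: Let_def u_def k_def)
  have "(Psi d r has_real_derivative D t) (at t)" for t
    unfolding eq u_def D_def using less.IH
    by (auto intro!: derivative_eq_intros DERIV_cdivide DERIV_sum simp: mult.commute)
  moreover have "deriv (Psi d r) = D"
    using calculation by (auto intro: DERIV_imp_deriv)
  moreover have "continuous_on UNIV D"
    unfolding D_def using less.IH by (auto intro!: continuous_intros simp: divide_inverse)
  ultimately show ?case by simp
qed

lemma Psi_has_derivative: "(Psi d r has_real_derivative deriv (Psi d r) t) (at t)"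
  using Psi_C1 by blast

lemma continuous_on_deriv_Psi: "continuous_on S (deriv (Psi d r))"
  using Psi_C1[of d r] continuous_on_subset[OF _ subset_UNIV] by blast

lemma continuous_on_Psi: "continuous_on S (Psi d r)"
  by (meson Psi_has_derivative DERIV_isCont continuous_at_imp_continuous_on)

lemma Psi_bounded:
  obtains B where "B > 0"
    "\<And>(r::'N::finite) t. t \<in> {-d..d} \<Longrightarrow> \<bar>Psi d (ix r) t\<bar> \<le> B \<and> \<bar>deriv (Psi d (ix r)) t\<bar> \<le> B"
proof -
  have "\<exists>B. \<forall>t\<in>{-d..d}. \<bar>Psi d (ix r) t\<bar> \<le> B \<and> \<bar>deriv (Psi d (ix r)) t\<bar> \<le> B" for r :: 'N
  proof -
    have "bounded (Psi d (ix r) ` {-d..d})" "bounded (deriv (Psi d (ix r)) ` {-d..d})"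
      by (intro compact_imp_bounded compact_continuous_image continuous_on_Psi continuous_on_deriv_Psi; simp)+
    then obtain B1 B2 where "\<forall>t\<in>{-d..d}. \<bar>Psi d (ix r) t\<bar> \<le> B1" "\<forall>t\<in>{-d..d}. \<bar>deriv (Psi d (ix r)) t\<bar> \<le> B2"
      unfolding bounded_iff by auto
    then show ?thesis by (intro exI[of _ "max B1 B2"]) fastforce
  qed
  then obtain B where B: "\<And>(r::'N) t. t \<in> {-d..d} \<Longrightarrow> \<bar>Psi d (ix r) t\<bar> \<le> B r \<and> \<bar>deriv (Psi d (ix r)) t\<bar> \<le> B r"
    by metis
  \<comment> \<open>Summing over the finite index type gives one bound for all basis functions;
    adding 1 makes it positive.\<close>
  have le: "B r \<le> (\<Sum>r\<in>UNIV. \<bar>B r\<bar>) + 1" for r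
    using member_le_sum[of r UNIV "\<lambda>r. \<bar>B r\<bar>"] by auto
  show ?thesis
  proof (rule that)
    show "(\<Sum>r\<in>UNIV. \<bar>B r\<bar>) + 1 > 0" by (simp add: add_nonneg_pos sum_nonneg)
  qed (use B le order_trans in blast)
qed

text \<open>A nonintegrable function has integral 0 by convention, and \<open>B\<close> is
  nonnegative because it bounds |f 0|. Entries given by integrals can thus be estimated straight
  from their integrands. The open interval matters because partial derivatives of \<open>K\<close>
  are bounded only at interior points.\<close>

lemma abs_integral_le:
  fixes f :: "real \<Rightarrow> real"
  assumes "d > 0" and le: "\<And>t. t \<in> {-d<..<d} \<Longrightarrow> \<bar>f t\<bar> \<le> B"
  shows "\<bar>integral {-d..d} f\<bar> \<le> 2 * d * B"
proof (cases "f integrable_on {-d..d}")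
  case True
  then have "f integrable_on {-d<..<d}" using integrable_on_open_interval_real by blast
  then have "norm (integral {-d<..<d} f) \<le> integral {-d<..<d} (\<lambda>t. B)"
    by (rule Henstock_Kurzweil_Integration.integral_norm_bound_integral)
      (use le integrable_on_open_interval_real[of "\<lambda>t. B"] in auto)
  then show ?thesis using \<open>d > 0\<close> by (simp add: integral_open_interval_real[symmetric])
next
  case False
  have "\<bar>f 0\<bar> \<le> B" using le[of 0] \<open>d > 0\<close> by simp
  then show ?thesis using False \<open>d > 0\<close> by (simp add: not_integrable_integral)
qed

text \<open>\<open>deriv\<close> is two-sided, so the formula for the \<alpha>-derivative in
  \<open>F_vec\<close> is available only inside the interval; the two endpoints carry no
  mass.\<close>

lemma integral_cong_open:
  fixes f g :: "real \<Rightarrow> real"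
  assumes "\<And>t. t \<in> {-d<..<d} \<Longrightarrow> f t = g t"
  shows "integral {-d..d} f = integral {-d..d} g"
  using integral_cong[of "{-d<..<d}" f g] assms integral_open_interval_real by metis

lemma norm_matrix_vector_le:
  fixes M :: "real^'N^'N" and v :: "real^'N"
  assumes "\<And>k r. \<bar>M $ k $ r\<bar> \<le> B"
  shows "norm (M *v v) \<le> real CARD('N) * real CARD('N) * B * norm v"
proof -
  have "\<bar>(M *v v) $ k\<bar> \<le> (\<Sum>r\<in>(UNIV::'N set). B * norm v)" for k
  proof -
    have "\<bar>(M *v v) $ k\<bar> \<le> (\<Sum>r\<in>UNIV. \<bar>M $ k $ r * v $ r\<bar>)"
      by (simp add: matrix_vector_mult_def sum_abs)
    also have "\<dots> \<le> (\<Sum>r\<in>(UNIV::'N set). B * norm v)"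
    proof (rule sum_mono)
      fix r
      have "0 \<le> B" using assms[of k r] abs_ge_zero order_trans by blast
      then show "\<bar>M $ k $ r * v $ r\<bar> \<le> B * norm v"
        unfolding abs_mult using assms component_le_norm_cart[of v r] by (intro mult_mono) auto
    qed
    finally show ?thesis .
  qed
  then have "(\<Sum>k\<in>UNIV. \<bar>(M *v v) $ k\<bar>) \<le> (\<Sum>k\<in>(UNIV::'N set). \<Sum>r\<in>(UNIV::'N set). B * norm v)"
    by (rule sum_mono)
  then show ?thesis using norm_le_l1_cart[of "M *v v"] by (simp add: mult.assoc)
qed

section \<open>The direction field and its quotients\<close>

lemma snd_nu: "snd (nu p \<alpha>) = snd p / norm (p - (axis ix1 \<alpha>, 0))"
  by (simp add: nu_def Let_def divide_inverse)

lemma fst_nu: "fst (nu p \<alpha>) $ i = (fst p $ i - axis ix1 \<alpha> $ i) / norm (p - (axis ix1 \<alpha>, 0))"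
  by (simp add: nu_def Let_def divide_inverse)

lemma norm_fst_snd_le: "norm (fst z) \<le> norm z" "norm (snd z) \<le> norm z"
  using norm_fst_le[of "fst z" "snd z"] norm_snd_le[of "snd z" "fst z"] by simp_all

lemma norm_ge_snd:
  fixes p :: "(real^'n) \<times> real"
  shows "\<bar>snd p\<bar> \<le> norm (p - (axis ix1 \<alpha>, 0))"
  using norm_fst_snd_le(2)[of "p - (axis ix1 \<alpha>, 0)"] by simp

text \<open>With q the vector from the source point, the derivative of q / |q| along a unit vector
  has two terms, from q and from 1 / |q|, each of size at most 1 / |q|.\<close>

lemma nu_deriv:
  fixes p :: "(real^'n) \<times> real"
  assumes "snd p > 0"
  obtains v where "(nu p has_vector_derivative v) (at \<alpha>)" "norm v \<le> 2 / norm (p - (axis ix1 \<alpha>, 0))"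
proof -
  define q where "q = (\<lambda>t. p - (axis ix1 t, 0) :: (real^'n) \<times> real)"
  define e :: "(real^'n) \<times> real" where "e = (axis ix1 1, 0)"
  have qe: "q = (\<lambda>t. p - t *\<^sub>R e)"
    by (auto simp: q_def e_def fun_eq_iff axis_def vec_eq_iff)
  have ne: "norm e = 1" by (simp add: e_def norm_Pair)
  have q0: "q \<alpha> \<noteq> 0" using assms norm_ge_snd[of p \<alpha>] by (auto simp: q_def)
  have nu: "nu p = (\<lambda>t. inverse (norm (q t)) *\<^sub>R q t)"
    by (simp add: nu_def q_def fun_eq_iff Let_def)
  let ?v = "- (inverse (norm (q \<alpha>)) *\<^sub>R e) + ((e \<bullet> sgn (q \<alpha>)) * inverse (norm (q \<alpha>)) ^ 2) *\<^sub>R q \<alpha>"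
  have dq: "(q has_derivative (\<lambda>h. - (h *\<^sub>R e))) (at \<alpha>)"
    unfolding qe by (auto intro!: derivative_eq_intros)
  have dn: "((\<lambda>t. norm (q t)) has_derivative (\<lambda>h. - (h *\<^sub>R e) \<bullet> sgn (q \<alpha>))) (at \<alpha>)"
    using has_derivative_compose[OF dq has_derivative_norm[OF q0]] by simp
  have "(nu p has_vector_derivative ?v) (at \<alpha>)"
    unfolding nu has_vector_derivative_def using q0 dn dq
    by (auto intro!: derivative_eq_intros simp: fun_eq_iff algebra_simps power2_eq_square)
  moreover have "norm ?v \<le> 2 / norm (q \<alpha>)"
  proof -
    have 1: "\<bar>e \<bullet> sgn (q \<alpha>)\<bar> \<le> 1"
      using Cauchy_Schwarz_ineq2[of e "sgn (q \<alpha>)"] ne q0 by (simp add: norm_sgn)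
    have "norm ?v \<le> norm (- (inverse (norm (q \<alpha>)) *\<^sub>R e))
        + norm (((e \<bullet> sgn (q \<alpha>)) * inverse (norm (q \<alpha>)) ^ 2) *\<^sub>R q \<alpha>)"
      by (rule norm_triangle_ineq)
    also have "\<dots> = inverse (norm (q \<alpha>)) + \<bar>e \<bullet> sgn (q \<alpha>)\<bar> * inverse (norm (q \<alpha>))"
      using q0 ne by (simp add: abs_mult power2_eq_square)
    also have "\<dots> \<le> inverse (norm (q \<alpha>)) + 1 * inverse (norm (q \<alpha>))"
      using 1 by (intro add_left_mono mult_right_mono) auto
    finally show ?thesis by (simp add: divide_inverse)
  qed
  ultimately show ?thesis using that by (simp add: q_def)
qed

text \<open>The derivative of \<nu> is of size 1 / |q|, and its last component is y / |q|, so the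
  unknown |q| cancels in the quotients and y > 1 absorbs the rest.\<close>

lemma nu_ratio_bounds:
  fixes p :: "(real^'n) \<times> real"
  assumes "snd p > 1"
  shows "\<bar>deriv (\<lambda>t. snd (nu p t)) \<alpha> / snd (nu p \<alpha>)\<bar> \<le> 2"
    and "\<bar>deriv (\<lambda>t. fst (nu p t) $ i) \<alpha> / snd (nu p \<alpha>)\<bar> \<le> 2"
    and "\<bar>fst (nu p \<alpha>) $ i / snd (nu p \<alpha>)\<bar> \<le> \<bar>fst p $ i\<bar> + \<bar>\<alpha>\<bar>"
proof -
  let ?n = "norm (p - (axis ix1 \<alpha>, 0))"
  have n: "?n > 0" using assms norm_ge_snd[of p \<alpha>] by linarith
  have s: "snd (nu p \<alpha>) > 0" unfolding snd_nu using n assms by simp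
  obtain v where v: "(nu p has_vector_derivative v) (at \<alpha>)" "norm v \<le> 2 / ?n"
    using nu_deriv[of p \<alpha>] assms by auto
  have key: "\<bar>x / snd (nu p \<alpha>)\<bar> \<le> 2" if "\<bar>x\<bar> \<le> norm v" for x
  proof -
    have "2 / ?n \<le> 2 * snd (nu p \<alpha>)"
      unfolding snd_nu using n assms by (simp add: divide_right_mono)
    then have "\<bar>x\<bar> \<le> 2 * snd (nu p \<alpha>)"
      using that v(2) by linarith
    then show ?thesis using s by (simp add: divide_le_eq)
  qed
  have "((\<lambda>t. snd (nu p t)) has_vector_derivative snd v) (at \<alpha>)"
    using v(1) bounded_linear.has_vector_derivative[OF bounded_linear_snd] by blast
  then have "deriv (\<lambda>t. snd (nu p t)) \<alpha> = snd v"
    by (intro DERIV_imp_deriv) (simp add: has_real_derivative_iff_has_vector_derivative)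
  then show "\<bar>deriv (\<lambda>t. snd (nu p t)) \<alpha> / snd (nu p \<alpha>)\<bar> \<le> 2"
    using key[of "snd v"] norm_fst_snd_le(2)[of v] by simp
  have "bounded_linear (\<lambda>z :: (real^'n) \<times> real. fst z $ i)"
    by (rule bounded_linear_compose[OF bounded_linear_vec_nth bounded_linear_fst])
  then have "((\<lambda>t. fst (nu p t) $ i) has_vector_derivative fst v $ i) (at \<alpha>)"
    using v(1) bounded_linear.has_vector_derivative by blast
  then have "deriv (\<lambda>t. fst (nu p t) $ i) \<alpha> = fst v $ i"
    by (intro DERIV_imp_deriv) (simp add: has_real_derivative_iff_has_vector_derivative)
  then show "\<bar>deriv (\<lambda>t. fst (nu p t) $ i) \<alpha> / snd (nu p \<alpha>)\<bar> \<le> 2"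
    using key[of "fst v $ i"] norm_fst_snd_le(1)[of v] component_le_norm_cart[of "fst v" i] by simp
  have "fst (nu p \<alpha>) $ i / snd (nu p \<alpha>) = (fst p $ i - axis ix1 \<alpha> $ i) / snd p"
    unfolding snd_nu fst_nu using n by simp
  also have "\<bar>\<dots>\<bar> \<le> \<bar>fst p $ i - axis ix1 \<alpha> $ i\<bar>"
    using assms by (simp add: divide_le_eq mult_left_le[of _ _] abs_mult mult_le_cancel_left1)
  also have "\<dots> \<le> \<bar>fst p $ i\<bar> + \<bar>\<alpha>\<bar>" by (auto simp: axis_def)
  finally show "\<bar>fst (nu p \<alpha>) $ i / snd (nu p \<alpha>)\<bar> \<le> \<bar>fst p $ i\<bar> + \<bar>\<alpha>\<bar>" .
qed

lemma matrix_bounds: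
  fixes A d a b :: real
  assumes "A > 0" "d > 0" "a > 1"
  obtains C where "C \<ge> 0"
    "\<And>p (v :: real^'N). p \<in> (Omega A a b :: ((real^'n) \<times> real) set) \<Longrightarrow> norm (D_mat d p *v v) \<le> C * norm v"
    "\<And>p (v :: real^'N) i. p \<in> (Omega A a b :: ((real^'n) \<times> real) set) \<Longrightarrow> norm (A_mat d i p *v v) \<le> C * norm v"
proof -
  obtain B where B: "B > 0"
    "\<And>(r::'N) t. t \<in> {-d..d} \<Longrightarrow> \<bar>Psi d (ix r) t\<bar> \<le> B \<and> \<bar>deriv (Psi d (ix r)) t\<bar> \<le> B"
    using Psi_bounded by blast
  \<comment> \<open>\<open>D_mat\<close> requires the factor 3 (1 from \<open>M_mat\<close>, 2 from
    \<open>A_last\<close>) and \<open>A_mat\<close> the factor A + d + 2; the sum A + d + 3 covers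
    both. The factor 2 d is the length of the interval.\<close>
  define L where "L = 2 * d * ((A + d + 3) * (B * B))"
  have BB: "B * B > 0" using B(1) by simp
  have nonneg: "L \<ge> 0" using assms B(1) by (simp add: L_def)
  have M: "\<bar>(M_mat d :: real^'N^'N) $ k $ r\<bar> \<le> 2 * d * (B * B)" for k r
    unfolding M_mat_def vec_lambda_beta using \<open>d > 0\<close>
  proof (rule abs_integral_le)
    fix t assume "t \<in> {-d<..<d}"
    then show "\<bar>deriv (Psi d (ix r)) t * Psi d (ix k) t\<bar> \<le> B * B"
      unfolding abs_mult using B by (intro mult_mono) auto
  qed
  have AL: "\<bar>(A_last d p :: real^'N^'N) $ k $ r\<bar> \<le> 2 * d * (2 * B * B)"
    if p: "p \<in> (Omega A a b :: ((real^'n) \<times> real) set)" for p k r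
    unfolding A_last_def vec_lambda_beta using \<open>d > 0\<close>
  proof (rule abs_integral_le)
    fix t assume "t \<in> {-d<..<d}"
    then show "\<bar>deriv (\<lambda>t. snd (nu p t)) t / snd (nu p t) * Psi d (ix r) t * Psi d (ix k) t\<bar> \<le> 2 * B * B"
      unfolding abs_mult using B p assms nu_ratio_bounds(1)[of p t] unfolding abs_mult
      by (intro mult_mono) (auto simp: Omega_def)
  qed
  have D: "\<bar>(D_mat d p :: real^'N^'N) $ k $ r\<bar> \<le> L"
    if p: "p \<in> (Omega A a b :: ((real^'n) \<times> real) set)" for p k r
  proof -
    have "\<bar>(D_mat d p :: real^'N^'N) $ k $ r\<bar> \<le> 2 * d * (B * B) + 2 * d * (2 * B * B)"
      using abs_triangle_ineq[of "(M_mat d :: real^'N^'N) $ k $ r" "A_last d p $ k $ r"] M[of k r] AL[OF p, of k r]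
      unfolding D_mat_def vector_add_component by linarith
    also have "\<dots> = 2 * d * (3 * (B * B))" by (simp add: algebra_simps)
    also have "\<dots> \<le> L" unfolding L_def using assms BB by (intro mult_left_mono mult_right_mono) auto
    finally show ?thesis .
  qed
  have AM: "\<bar>(A_mat d i p :: real^'N^'N) $ k $ r\<bar> \<le> L"
    if p: "p \<in> (Omega A a b :: ((real^'n) \<times> real) set)" for p k r i
    unfolding A_mat_def vec_lambda_beta L_def using \<open>d > 0\<close>
  proof (rule abs_integral_le)
    fix t assume t: "t \<in> {-d<..<d}"
    have s: "snd p > 1" using p assms by (auto simp: Omega_def)
    have "\<bar>fst p $ i\<bar> + \<bar>t\<bar> \<le> A + d"
    proof -
      have "- A < fst p $ i" "fst p $ i < A" using p by (auto simp: Omega_def)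
      then show ?thesis using t by auto
    qed
    then have 1: "\<bar>fst (nu p t) $ i / snd (nu p t)\<bar> \<le> A + d"
      using nu_ratio_bounds(3)[OF s, of t i] by linarith
    have "\<bar>fst (nu p t) $ i / snd (nu p t) * deriv (Psi d (ix r)) t +
        deriv (\<lambda>t. fst (nu p t) $ i) t / snd (nu p t) * Psi d (ix r) t\<bar>
      \<le> \<bar>fst (nu p t) $ i / snd (nu p t)\<bar> * \<bar>deriv (Psi d (ix r)) t\<bar> +
        \<bar>deriv (\<lambda>t. fst (nu p t) $ i) t / snd (nu p t)\<bar> * \<bar>Psi d (ix r) t\<bar>"
      unfolding abs_mult[symmetric] by (rule abs_triangle_ineq)
    also have "\<dots> \<le> (A + d) * B + 2 * B"
      using 1 nu_ratio_bounds(2)[OF s, of i t] B t assms by (intro add_mono mult_mono) auto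
    finally have "\<bar>(fst (nu p t) $ i / snd (nu p t) * deriv (Psi d (ix r)) t +
        deriv (\<lambda>t. fst (nu p t) $ i) t / snd (nu p t) * Psi d (ix r) t) * Psi d (ix k) t\<bar>
      \<le> ((A + d) * B + 2 * B) * B"
      unfolding abs_mult[of _ "Psi d (ix k) t"] using B t assms by (intro mult_mono) auto
    also have "\<dots> \<le> (A + d + 3) * (B * B)" using BB by (simp add: algebra_simps)
    finally show "\<bar>(fst (nu p t) $ i / snd (nu p t) * deriv (Psi d (ix r)) t +
        deriv (\<lambda>t. fst (nu p t) $ i) t / snd (nu p t) * Psi d (ix r) t) * Psi d (ix k) t\<bar>
      \<le> (A + d + 3) * (B * B)" .
  qed
  show ?thesis
  proof (rule that[of "real CARD('N) * real CARD('N) * L"])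
  qed (use nonneg D AM in \<open>auto intro!: norm_matrix_vector_le\<close>)
qed

section \<open>Lipschitz continuity of the nonlinearity\<close>

text \<open>Compactness makes the suprema in \<open>C1_norm\<close> finite, so they bound each
  value. The nonempty interior makes every supremum nonnegative, so that a single partial derivative
  is dominated by the whole sum.\<close>

lemma C2_on_C1_norm:
  fixes f :: "'a::euclidean_space \<Rightarrow> real"
  assumes f: "C2_on S f" and S: "compact S" and ne: "interior S \<noteq> {}"
  obtains f' where "\<And>p. p \<in> S \<Longrightarrow> (f has_derivative blinfun_apply (f' p)) (at p within S)"
    "continuous_on S f'" "continuous_on S f"
    "\<And>p. p \<in> S \<Longrightarrow> \<bar>f p\<bar> \<le> C1_norm S f"
    "\<And>p e. p \<in> interior S \<Longrightarrow> e \<in> Basis \<Longrightarrow> \<bar>blinfun_apply (f' p) e\<bar> \<le> C1_norm S f"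
proof -
  obtain f' f'' where f': "\<And>p. p \<in> S \<Longrightarrow> (f has_derivative blinfun_apply (f' p)) (at p within S)"
    and f'': "\<And>p. p \<in> S \<Longrightarrow> (f' has_derivative blinfun_apply (f'' p)) (at p within S)"
    using f unfolding C2_on_def by blast
  have c: "continuous_on S f" "continuous_on S f'"
    using f' f'' has_derivative_continuous continuous_on_eq_continuous_within by blast+
  let ?d = "\<lambda>e p. \<bar>frechet_derivative f (at p) e\<bar>"
  have fd: "frechet_derivative f (at p) = blinfun_apply (f' p)" if "p \<in> interior S" for p
    using f'[of p] that by (metis at_within_interior frechet_derivative_at interior_subset subsetD)
  have "bounded (f ` S)" "bounded (f' ` S)"
    using c S by (auto intro: compact_imp_bounded compact_continuous_image)
  then obtain B B' where B: "\<And>p. p \<in> S \<Longrightarrow> \<bar>f p\<bar> \<le> B" and B': "\<And>p. p \<in> S \<Longrightarrow> norm (f' p) \<le> B'"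
    unfolding bounded_iff by auto
  have bdd: "bdd_above ((\<lambda>p. \<bar>f p\<bar>) ` S)" using B by (rule bdd_aboveI2)
  have bdd': "bdd_above (?d e ` interior S)" for e
  proof (rule bdd_aboveI2)
    fix p assume p: "p \<in> interior S"
    then have pS: "p \<in> S" using interior_subset by blast
    have "?d e p \<le> norm (f' p) * norm e" using norm_blinfun[of "f' p" e] fd[OF p] by simp
    also have "\<dots> \<le> B' * norm e" using B'[OF pS] by (rule mult_right_mono) simp
    finally show "?d e p \<le> B' * norm e" .
  qed
  obtain p0 where p0: "p0 \<in> interior S" using ne by blast
  have le1: "\<bar>f p\<bar> \<le> (SUP p\<in>S. \<bar>f p\<bar>)" if "p \<in> S" for p
    using that bdd by (rule cSUP_upper)
  have le2: "?d e p \<le> (SUP p\<in>interior S. ?d e p)" if "p \<in> interior S" for e p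
    using that bdd' by (rule cSUP_upper)
  have nn2: "(SUP p\<in>interior S. ?d e p) \<ge> 0" for e
    using le2[OF p0] abs_ge_zero order_trans by blast
  have nn1: "(SUP p\<in>S. \<bar>f p\<bar>) \<ge> 0"
    using le1[of p0] p0 interior_subset abs_ge_zero order_trans by blast
  show ?thesis
  proof (rule that[of f'])
    show "\<bar>f p\<bar> \<le> C1_norm S f" if "p \<in> S" for p
      using le1[OF that] sum_nonneg[of Basis "\<lambda>e. SUP p\<in>interior S. ?d e p"] nn2
      by (simp add: C1_norm_def)
    show "\<bar>blinfun_apply (f' p) e\<bar> \<le> C1_norm S f" if p: "p \<in> interior S" and e: "e \<in> Basis" for p e
    proof -
      have "\<bar>blinfun_apply (f' p) e\<bar> \<le> (SUP p\<in>interior S. ?d e p)"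
        using le2[OF p, of e] fd[OF p] by simp
      also have "\<dots> \<le> (\<Sum>e\<in>Basis. SUP p\<in>interior S. ?d e p)"
        using member_le_sum[of e Basis "\<lambda>e. SUP p\<in>interior S. ?d e p"] nn2 e by auto
      finally show ?thesis using nn1 by (simp add: C1_norm_def)
    qed
  qed (use f' c in auto)
qed

section \<open>The domain boxes\<close>

lemma Omega_bounded: "bounded (Omega A a b :: ((real^'n) \<times> real) set)"
proof -
  have "(Omega A a b :: ((real^'n) \<times> real) set) \<subseteq> cbox (\<chi> i. -A) (\<chi> i. A) \<times> cbox a b"
    by (auto simp: Omega_def mem_box_cart less_imp_le)
  then show ?thesis
    by (rule bounded_subset[rotated]) (intro bounded_Times bounded_cbox)
qed

lemma Omega_open: "open (Omega A a b :: ((real^'n) \<times> real) set)"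
proof -
  have "(Omega A a b :: ((real^'n) \<times> real) set) = box (\<chi> i. -A) (\<chi> i. A) \<times> {a<..<b}"
    by (auto simp: Omega_def mem_box_cart)
  then show ?thesis by (simp only:) (intro open_Times open_box open_greaterThanLessThan)
qed

lemma KDom_interior:
  assumes "p \<in> Omega A a b" "\<alpha> \<in> {-d<..<d}" "\<beta> \<in> {-d<..<d}"
  shows "(p, \<alpha>, \<beta>) \<in> interior (KDom A d a b)"
proof (rule interiorI)
  show "open (Omega A a b \<times> {-d<..<d} \<times> {-d<..<d})"
    by (intro open_Times Omega_open open_greaterThanLessThan)
  show "Omega A a b \<times> {-d<..<d} \<times> {-d<..<d} \<subseteq> KDom A d a b"
    unfolding KDom_def using closure_subset[of "Omega A a b"] by force
qed (use assms in auto)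

lemma KDom_compact: "compact (KDom A d a b :: (((real^'n) \<times> real) \<times> real \<times> real) set)"
  unfolding KDom_def by (intro compact_Times) (simp_all add: Omega_bounded)

text \<open>Local Lipschitz bound from 1 + z \<le> exp z, applied with z = y - x for y \<le>
  x.\<close>

lemma exp_diff_le:
  fixes x y :: real
  assumes "\<bar>x\<bar> \<le> E" "\<bar>y\<bar> \<le> E"
  shows "\<bar>exp x - exp y\<bar> \<le> exp E * \<bar>x - y\<bar>"
proof -
  have *: "exp x - exp y \<le> exp E * (x - y)" if "y \<le> x" "x \<le> E" for x y :: real
  proof -
    have "exp x * (1 - exp (y - x)) \<le> exp x * (x - y)"
      using exp_ge_add_one_self[of "y - x"] by (intro mult_left_mono exp_ge_zero) linarith
    also have "\<dots> \<le> exp E * (x - y)" using that by (intro mult_right_mono) auto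
    finally show ?thesis by (simp add: algebra_simps flip: exp_add)
  qed
  show ?thesis
  proof (cases "y \<le> x")
    case True
    then show ?thesis using *[of y x] assms by simp
  next
    case False
    then show ?thesis using *[of x y] assms by simp
  qed
qed

lemma abs_sum_mult_le:
  fixes w :: "real^'N"
  assumes "\<And>r. \<bar>g r\<bar> \<le> B"
  shows "\<bar>\<Sum>r\<in>UNIV. w $ r * g r\<bar> \<le> real CARD('N) * norm w * B"
proof -
  have "\<bar>\<Sum>r\<in>UNIV. w $ r * g r\<bar> \<le> (\<Sum>r\<in>UNIV. \<bar>w $ r * g r\<bar>)" by (rule sum_abs)
  also have "\<dots> \<le> (\<Sum>r\<in>(UNIV :: 'N set). norm w * B)"
    unfolding abs_mult using assms component_le_norm_cart[of w] by (intro sum_mono mult_mono) auto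
  finally show ?thesis by simp
qed

text \<open>
  The \<open>\<alpha>\<close>-derivative in \<open>F\<close> is \<open>\<integral> F_kernel\<close>: the two exponentials are merged into one, so that
  differentiation under the integral sign acts on a single product.
\<close>

definition F_kernel :: "real \<Rightarrow> (real \<Rightarrow> real \<Rightarrow> real) \<Rightarrow> (real \<Rightarrow> real \<Rightarrow> real) \<Rightarrow> real^'N \<Rightarrow> real \<Rightarrow> real \<Rightarrow> real" where
  "F_kernel d k k' w t \<beta> = (k' t \<beta> - k t \<beta> * (\<Sum>r\<in>UNIV. w $ r * deriv (Psi d (ix r)) t)) *
     exp (\<Sum>r\<in>UNIV. w $ r * (Psi d (ix r) \<beta> - Psi d (ix r) t))"

text \<open>Leibniz's rule with the parameter in the open interval, where the derivative within the
  set is the two-sided one. The continuity part also provides integrability of the kernel later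
  on.\<close>

lemma F_kernel_deriv:
  fixes w :: "real^'N"
  assumes k: "\<And>t \<beta>. t \<in> {-d<..<d} \<Longrightarrow> \<beta> \<in> {-d..d} \<Longrightarrow> ((\<lambda>t. k t \<beta>) has_real_derivative k' t \<beta>) (at t)"
    and ck: "continuous_on ({-d..d} \<times> {-d..d}) (\<lambda>(t, \<beta>). k t \<beta>)"
    and ck': "continuous_on ({-d..d} \<times> {-d..d}) (\<lambda>(t, \<beta>). k' t \<beta>)"
  shows "continuous_on ({-d..d} \<times> {-d..d}) (\<lambda>(t, \<beta>). F_kernel d k k' w t \<beta>)"
    and "t \<in> {-d<..<d} \<Longrightarrow>
      deriv (\<lambda>t. exp (- (\<Sum>r\<in>UNIV. w $ r * Psi d (ix r) t)) *
        integral {-d..d} (\<lambda>\<beta>. k t \<beta> * exp (\<Sum>r\<in>UNIV. w $ r * Psi d (ix r) \<beta>))) t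
      = integral {-d..d} (F_kernel d k k' w t)"
proof -
  let ?E = "\<lambda>t \<beta>. exp (\<Sum>r\<in>UNIV. w $ r * (Psi d (ix r) \<beta> - Psi d (ix r) t))"
  have cE: "continuous_on S (\<lambda>z. ?E (fst z) (snd z))" for S
    by (intro continuous_intros continuous_on_compose2[OF continuous_on_Psi[of UNIV]]) auto
  have cK: "continuous_on ({-d..d} \<times> {-d..d}) (\<lambda>z. F_kernel d k k' w (fst z) (snd z))"
    unfolding F_kernel_def
    using ck ck' by (intro continuous_intros cE continuous_on_compose2[OF continuous_on_deriv_Psi[of UNIV]])
      (auto simp: case_prod_unfold)
  then show cont: "continuous_on ({-d..d} \<times> {-d..d}) (\<lambda>(t, \<beta>). F_kernel d k k' w t \<beta>)"
    by (simp add: case_prod_unfold)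
  have ckE: "continuous_on ({-d..d} \<times> {-d..d}) (\<lambda>z. k (fst z) (snd z) * ?E (fst z) (snd z))"
    using ck by (intro continuous_intros cE) (simp add: case_prod_unfold)
  assume t: "t \<in> {-d<..<d}"
  have "((\<lambda>t. integral (cbox (-d) d) (\<lambda>\<beta>. k t \<beta> * ?E t \<beta>)) has_field_derivative
      integral (cbox (-d) d) (F_kernel d k k' w t)) (at t within {-d<..<d})"
  proof (rule leibniz_rule_field_derivative)
    fix s \<beta> assume s: "s \<in> {-d<..<d}" and \<beta>: "\<beta> \<in> cbox (-d) d"
    show "((\<lambda>t. k t \<beta> * ?E t \<beta>) has_field_derivative F_kernel d k k' w s \<beta>) (at s within {-d<..<d})"
      unfolding F_kernel_def
      by (rule DERIV_subset[OF _ subset_UNIV])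
        (use s \<beta> in \<open>auto intro!: derivative_eq_intros DERIV_sum k Psi_has_derivative
          simp: sum_negf algebra_simps\<close>)
  next
    fix s assume "s \<in> {-d<..<d}"
    then have "continuous_on {-d..d} (\<lambda>\<beta>. k s \<beta> * ?E s \<beta>)"
      by (intro continuous_on_compose2[OF ckE, of _ "\<lambda>\<beta>. (s, \<beta>)", simplified] continuous_intros) auto
    then show "(\<lambda>\<beta>. k s \<beta> * ?E s \<beta>) integrable_on cbox (-d) d"
      using integrable_continuous_real by simp
  next
    show "continuous_on ({-d<..<d} \<times> cbox (-d) d) (\<lambda>(x, t). F_kernel d k k' w x t)"
      using cont by (rule continuous_on_subset) auto
  qed (use t in auto)
  then have "((\<lambda>t. integral {-d..d} (\<lambda>\<beta>. k t \<beta> * ?E t \<beta>)) has_field_derivative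
      integral {-d..d} (F_kernel d k k' w t)) (at t)"
    using t by (simp add: at_within_open[of t "{-d<..<d}"])
  \<comment> \<open>The outer exponential does not depend on \<beta>, so it moves under the integral
    and merges with the inner one.\<close>
  moreover have "exp (- (\<Sum>r\<in>UNIV. w $ r * Psi d (ix r) t)) *
        integral {-d..d} (\<lambda>\<beta>. k t \<beta> * exp (\<Sum>r\<in>UNIV. w $ r * Psi d (ix r) \<beta>))
      = integral {-d..d} (\<lambda>\<beta>. k t \<beta> * ?E t \<beta>)" for t
    by (subst integral_mult_right[symmetric], rule integral_cong)
      (simp add: exp_minus exp_diff right_diff_distrib sum_subtractf divide_inverse)
  ultimately show "deriv (\<lambda>t. exp (- (\<Sum>r\<in>UNIV. w $ r * Psi d (ix r) t)) *
        integral {-d..d} (\<lambda>\<beta>. k t \<beta> * exp (\<Sum>r\<in>UNIV. w $ r * Psi d (ix r) \<beta>))) t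
      = integral {-d..d} (F_kernel d k k' w t)"
    by (simp add: DERIV_imp_deriv)
qed

text \<open>The kernel is an affine function of \<open>w\<close> times the exponential of a linear
  one, so both factors are bounded and Lipschitz on a ball of radius \<open>M\<close>. The 2 B
  bounds the difference of two values of a basis function.\<close>

lemma F_kernel_lipschitz:
  fixes w1 w2 :: "real^'N"
  assumes B: "\<And>(r::'N) t. t \<in> {-d..d} \<Longrightarrow> \<bar>Psi d (ix r) t\<bar> \<le> B \<and> \<bar>deriv (Psi d (ix r)) t\<bar> \<le> B"
    and k: "\<bar>k t \<beta>\<bar> \<le> \<kappa>" "\<bar>k' t \<beta>\<bar> \<le> \<kappa>"
    and t: "t \<in> {-d..d}" "\<beta> \<in> {-d..d}"
    and w: "norm w1 \<le> M" "norm w2 \<le> M"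
  shows "\<bar>F_kernel d k k' w1 t \<beta> - F_kernel d k k' w2 t \<beta>\<bar> \<le>
    ((\<kappa> + \<kappa> * (real CARD('N) * M * B)) * (exp (real CARD('N) * M * (2 * B)) * (real CARD('N) * (2 * B)))
      + \<kappa> * (real CARD('N) * B) * exp (real CARD('N) * M * (2 * B))) * norm (w1 - w2)"
proof -
  let ?n = "real CARD('N)"
  define S where "S w = (\<Sum>r\<in>UNIV. w $ r * (Psi d (ix r) \<beta> - Psi d (ix r) t))" for w :: "real^'N"
  define T where "T w = (\<Sum>r\<in>UNIV. w $ r * deriv (Psi d (ix r)) t)" for w :: "real^'N"
  let ?E = "exp (?n * M * (2 * B))"
  have B0: "B \<ge> 0" using B[OF t(1)] abs_ge_zero order_trans by blast
  have \<kappa>0: "\<kappa> \<ge> 0" using k(1) abs_ge_zero order_trans by blast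
  have M0: "M \<ge> 0" using w(1) norm_ge_zero order_trans by blast
  have Sb: "\<bar>S w\<bar> \<le> ?n * norm w * (2 * B)" for w
    unfolding S_def
  proof (rule abs_sum_mult_le)
    show "\<bar>Psi d (ix r) \<beta> - Psi d (ix r) t\<bar> \<le> 2 * B" for r :: 'N
      using B[OF t(1), of r] B[OF t(2), of r] by linarith
  qed
  have Tb: "\<bar>T w\<bar> \<le> ?n * norm w * B" for w
    unfolding T_def using B[OF t(1)] by (intro abs_sum_mult_le) auto
  have SM: "\<bar>S w\<bar> \<le> ?n * M * (2 * B)" if "norm w \<le> M" for w
    using Sb[of w] that B0 by (meson mult_left_mono mult_right_mono of_nat_0_le_iff order_trans zero_le_mult_iff zero_le_numeral)
  have TM: "\<bar>T w\<bar> \<le> ?n * M * B" if "norm w \<le> M" for w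
    using Tb[of w] that B0 by (meson mult_left_mono mult_right_mono of_nat_0_le_iff order_trans)
  have lin: "S w1 - S w2 = S (w1 - w2)" "T w1 - T w2 = T (w1 - w2)"
    by (simp_all add: S_def T_def left_diff_distrib sum_subtractf)
  have e1: "\<bar>exp (S w1) - exp (S w2)\<bar> \<le> ?E * (?n * norm (w1 - w2) * (2 * B))"
    using exp_diff_le[OF SM[OF w(1)] SM[OF w(2)]] Sb[of "w1 - w2"] unfolding lin
    by (meson exp_ge_zero mult_left_mono order_trans)
  have e2: "exp (S w2) \<le> ?E" using SM[OF w(2)] by simp
  have k1: "\<bar>k' t \<beta> - k t \<beta> * T w1\<bar> \<le> \<kappa> + \<kappa> * (?n * M * B)"
  proof -
    have "\<bar>k t \<beta> * T w1\<bar> \<le> \<kappa> * (?n * M * B)"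
      unfolding abs_mult using k TM[OF w(1)] \<kappa>0 by (intro mult_mono) auto
    then show ?thesis using k(2) by linarith
  qed
  \<comment> \<open>Product rule for differences: one factor changes at a time, and each change is
    linear in w1 - w2.\<close>
  have "F_kernel d k k' w1 t \<beta> - F_kernel d k k' w2 t \<beta>
    = (k' t \<beta> - k t \<beta> * T w1) * (exp (S w1) - exp (S w2)) - k t \<beta> * (T w1 - T w2) * exp (S w2)"
    unfolding F_kernel_def S_def[symmetric] T_def[symmetric] by (simp add: algebra_simps)
  also have "\<bar>\<dots>\<bar> \<le> \<bar>k' t \<beta> - k t \<beta> * T w1\<bar> * \<bar>exp (S w1) - exp (S w2)\<bar> + \<bar>k t \<beta>\<bar> * \<bar>T (w1 - w2)\<bar> * exp (S w2)"
    unfolding lin by (rule order_trans[OF abs_triangle_ineq4]) (simp add: abs_mult)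
  also have "\<dots> \<le> (\<kappa> + \<kappa> * (?n * M * B)) * (?E * (?n * norm (w1 - w2) * (2 * B)))
      + \<kappa> * (?n * norm (w1 - w2) * B) * ?E"
    using k1 e1 e2 k(1) Tb[of "w1 - w2"] \<kappa>0 B0 M0 by (intro add_mono mult_mono) auto
  finally show ?thesis by (simp add: algebra_simps)
qed

lemma mu_bounded:
  fixes mu :: "(real^'n) \<times> real \<Rightarrow> real"
  assumes "C2_on UNIV mu"
  obtains B where "B \<ge> 0" "\<And>p. p \<in> Omega A a b \<Longrightarrow> \<bar>mu p\<bar> \<le> B"
proof -
  obtain mu' where "\<And>p. (mu has_derivative blinfun_apply (mu' p)) (at p)"
    using assms unfolding C2_on_def by auto
  then have "continuous_on UNIV mu"
    by (meson continuous_at_imp_continuous_on has_derivative_continuous)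
  then have "bounded (mu ` closure (Omega A a b))"
    by (intro compact_imp_bounded compact_continuous_image)
      (auto intro: continuous_on_subset simp: Omega_bounded)
  then obtain B where "\<And>p. p \<in> closure (Omega A a b) \<Longrightarrow> \<bar>mu p\<bar> \<le> B"
    unfolding bounded_iff by auto
  then show ?thesis
    using that[of "max B 0"] closure_subset by (metis max.cobounded2 max.coboundedI1 subsetD)
qed

lemma axis_eq_scaleR: "axis i t = t *\<^sub>R (axis i 1 :: real^'n)"
  by (simp add: axis_def vec_eq_iff)

text \<open>Replaces the \<open>deriv\<close> in the definition by an integral, after which the
  integrand is continuous up to the endpoints. Its integrability is what allows two such components
  to be subtracted under one integral.\<close>

lemma F_vec_component:
  fixes p :: "(real^'n) \<times> real" and w :: "real^'N" and mu :: "(real^'n) \<times> real \<Rightarrow> real"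
  assumes d: "d > 0" and p: "p \<in> Omega A a b" and a: "a > 1"
    and k: "\<And>t \<beta>. t \<in> {-d<..<d} \<Longrightarrow> \<beta> \<in> {-d..d} \<Longrightarrow> ((\<lambda>t. K (p, t, \<beta>)) has_real_derivative k' t \<beta>) (at t)"
    and ck: "continuous_on ({-d..d} \<times> {-d..d}) (\<lambda>(t, \<beta>). K (p, t, \<beta>))"
    and ck': "continuous_on ({-d..d} \<times> {-d..d}) (\<lambda>(t, \<beta>). k' t \<beta>)"
  defines "g \<equiv> \<lambda>k t. mu p / snd (nu p t) *
      integral {-d..d} (F_kernel d (\<lambda>t \<beta>. K (p, t, \<beta>)) k' w t) * Psi d (ix k) t"
  shows "F_vec d mu K w p $ k = - integral {-d..d} (g k)" and "g k integrable_on {-d..d}"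
proof -
  note FK = F_kernel_deriv[of d "\<lambda>t \<beta>. K (p, t, \<beta>)" k', OF k ck ck']
  show "F_vec d mu K w p $ k = - integral {-d..d} (g k)"
    unfolding F_vec_def vec_lambda_beta g_def
    by (intro arg_cong[of _ _ uminus] integral_cong_open) (simp only: FK(2))
  have c1: "continuous_on {-d..d} (\<lambda>t. integral {-d..d} (F_kernel d (\<lambda>t \<beta>. K (p, t, \<beta>)) k' w t))"
    unfolding cbox_interval[symmetric] by (rule integral_continuous_on_param) (use FK(1) in simp)
  \<comment> \<open>This function is the reciprocal of the last component of \<nu>; its denominator
    y exceeds 1.\<close>
  have c2: "continuous_on {-d..d} (\<lambda>t. norm (p - (axis ix1 t, 0)) / snd p)"
  proof -
    have eq: "(\<lambda>t. norm (p - (axis ix1 t, 0)) / snd p) = (\<lambda>t. norm (p - t *\<^sub>R (axis ix1 1, 0)) / snd p)"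
      by (subst axis_eq_scaleR) simp
    have "snd p \<noteq> 0" using p a by (auto simp: Omega_def)
    then show ?thesis unfolding eq by (intro continuous_intros) simp
  qed
  have "continuous_on {-d..d} (\<lambda>t. mu p * (norm (p - (axis ix1 t, 0)) / snd p) *
      integral {-d..d} (F_kernel d (\<lambda>t \<beta>. K (p, t, \<beta>)) k' w t) * Psi d (ix k) t)"
    by (intro continuous_on_mult continuous_on_const continuous_on_Psi c1 c2)
  then show "g k integrable_on {-d..d}"
    unfolding g_def snd_nu by (simp add: integrable_continuous_real)
qed

text \<open>The order of quantifiers is the point: \<open>C\<close> is produced before
  \<open>K\<close>, so one constant serves all kernels with the same C^1 norm.\<close>

lemma F_lipschitz:
  fixes mu :: "(real^'n) \<times> real \<Rightarrow> real"
  assumes d: "d > 0" and a: "1 < a" and mu: "C2_on UNIV mu" and M: "M \<ge> 0"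
  obtains C where "C \<ge> 0"
    "\<And>K p (w1 :: real^'N) w2. C2_on (KDom A d a b) K \<Longrightarrow> C1_norm (KDom A d a b) K = \<kappa> \<Longrightarrow>
      p \<in> Omega A a b \<Longrightarrow> norm w1 \<le> M \<Longrightarrow> norm w2 \<le> M \<Longrightarrow>
      norm (F_vec d mu K w1 p - F_vec d mu K w2 p) \<le> C * norm (w1 - w2)"
proof -
  obtain B where B: "B > 0"
    "\<And>(r::'N) t. t \<in> {-d..d} \<Longrightarrow> \<bar>Psi d (ix r) t\<bar> \<le> B \<and> \<bar>deriv (Psi d (ix r)) t\<bar> \<le> B"
    using Psi_bounded by blast
  obtain m where m: "m \<ge> 0" "\<And>p. p \<in> Omega A a b \<Longrightarrow> \<bar>mu p\<bar> \<le> m"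
    using mu_bounded[OF mu] by blast
  obtain L where L: "L > 0" "\<And>p :: (real^'n) \<times> real. p \<in> Omega A a b \<Longrightarrow> norm p \<le> L"
    using Omega_bounded[of A a b] unfolding bounded_pos by blast
  let ?n = "real CARD('N)"
  \<comment> \<open>This is the constant of \<open>F_kernel_lipschitz\<close>. The absolute value
    makes it nonnegative before any kernel is given; once one is, \<kappa> bounds |K| and equals its
    absolute value. In \<open>C\<close> the factors bound, in turn, the \<alpha>-integral,
    \<open>mu\<close>, the reciprocal of the last component of \<nu>, the \<beta>-integral and the
    basis function.\<close>
  define \<Lambda> where "\<Lambda> = (\<bar>\<kappa>\<bar> + \<bar>\<kappa>\<bar> * (?n * M * B)) * (exp (?n * M * (2 * B)) * (?n * (2 * B)))
      + \<bar>\<kappa>\<bar> * (?n * B) * exp (?n * M * (2 * B))"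
  define C where "C = 2 * d * (m * (L + d) * (2 * d * \<Lambda>) * B)"
  have L0: "\<Lambda> \<ge> 0" using M B(1) by (simp add: \<Lambda>_def)
  have C0: "C \<ge> 0" using L0 m(1) L(1) d B(1) by (simp add: C_def)
  have main: "\<bar>F_vec d mu K w1 p $ k - F_vec d mu K w2 p $ k\<bar> \<le> C * norm (w1 - w2)"
    if K: "C2_on (KDom A d a b) K" "C1_norm (KDom A d a b) K = \<kappa>"
      and p: "p \<in> Omega A a b" and w: "norm w1 \<le> M" "norm w2 \<le> M"
    for K p and w1 w2 :: "real^'N" and k
  proof -
    have int: "(p, t, \<beta>) \<in> interior (KDom A d a b)" if "t \<in> {-d<..<d}" "\<beta> \<in> {-d<..<d}" for t \<beta>
      using KDom_interior[OF p that] .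
    have mem: "(p, t, \<beta>) \<in> KDom A d a b" if "t \<in> {-d..d}" "\<beta> \<in> {-d..d}" for t \<beta>
      using p that closure_subset[of "Omega A a b"] by (auto simp: KDom_def)
    have ne: "interior (KDom A d a b :: (((real^'n) \<times> real) \<times> real \<times> real) set) \<noteq> {}"
      using int[of 0 0] d by auto
    obtain f' where f': "\<And>q. q \<in> KDom A d a b \<Longrightarrow> (K has_derivative blinfun_apply (f' q)) (at q within KDom A d a b)"
      and cont: "continuous_on (KDom A d a b) f'" "continuous_on (KDom A d a b) K"
      and bnd: "\<And>q. q \<in> KDom A d a b \<Longrightarrow> \<bar>K q\<bar> \<le> \<kappa>"
        "\<And>q e. q \<in> interior (KDom A d a b) \<Longrightarrow> e \<in> Basis \<Longrightarrow> \<bar>blinfun_apply (f' q) e\<bar> \<le> \<kappa>"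
      using C2_on_C1_norm[OF K(1) KDom_compact ne] K(2) by metis
    let ?e = "(0, 1, 0) :: ((real^'n) \<times> real) \<times> real \<times> real"
    define k' where "k' t \<beta> = blinfun_apply (f' (p, t, \<beta>)) ?e" for t \<beta>
    have e: "?e \<in> Basis" by (simp add: Basis_prod_def)
    \<comment> \<open>\<beta> may be an endpoint, where the point is on the boundary of the box. The
      derivative within the box is therefore restricted to the segment in the direction of \<alpha>,
      in which \<open>t\<close> is interior.\<close>
    have dk: "((\<lambda>t. K (p, t, \<beta>)) has_real_derivative k' t \<beta>) (at t)"
      if t: "t \<in> {-d<..<d}" and \<beta>: "\<beta> \<in> {-d..d}" for t \<beta>
    proof -
      have "((\<lambda>t. (p, t, \<beta>)) has_derivative (\<lambda>h. (0, h, 0))) (at t within {-d<..<d})"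
        by (auto intro!: derivative_eq_intros)
      moreover have "(K has_derivative blinfun_apply (f' (p, t, \<beta>)))
          (at (p, t, \<beta>) within (\<lambda>t. (p, t, \<beta>)) ` {-d<..<d})"
        by (rule has_derivative_subset[OF f']) (use mem t \<beta> in auto)
      ultimately have "((\<lambda>t. K (p, t, \<beta>)) has_derivative (\<lambda>h. blinfun_apply (f' (p, t, \<beta>)) (0, h, 0)))
          (at t within {-d<..<d})"
        by (rule has_derivative_in_compose)
      moreover have "blinfun_apply (f' (p, t, \<beta>)) (0, h, 0) = k' t \<beta> * h" for h
        using blinfun.scaleR_right[of "f' (p, t, \<beta>)" h ?e] by (simp add: k'_def mult.commute)
      ultimately show ?thesis
        using t by (simp add: has_field_derivative_def at_within_open[of t "{-d<..<d}"])
    qed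
    have slice: "(\<lambda>z. (p, z)) ` ({-d..d} \<times> {-d..d}) \<subseteq> KDom A d a b" using mem by auto
    have ck: "continuous_on ({-d..d} \<times> {-d..d}) (\<lambda>(t, \<beta>). K (p, t, \<beta>))"
      using continuous_on_compose2[OF cont(2) _ slice] by (simp add: case_prod_unfold continuous_intros)
    have "continuous_on ({-d..d} \<times> {-d..d}) (\<lambda>z. f' (p, z))"
      using continuous_on_compose2[OF cont(1) _ slice] by (simp add: continuous_intros)
    then have ck': "continuous_on ({-d..d} \<times> {-d..d}) (\<lambda>(t, \<beta>). k' t \<beta>)"
      unfolding k'_def by (simp add: case_prod_unfold continuous_intros)
    let ?H = "\<lambda>w. F_kernel d (\<lambda>t \<beta>. K (p, t, \<beta>)) k' w"
    let ?g = "\<lambda>w t. mu p / snd (nu p t) * integral {-d..d} (?H w t) * Psi d (ix k) t"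
    have F: "F_vec d mu K w p $ k = - integral {-d..d} (?g w)" "?g w integrable_on {-d..d}" for w :: "real^'N"
      by (rule F_vec_component[OF d p a dk ck ck'], assumption+)+
    have \<kappa>: "\<bar>\<kappa>\<bar> = \<kappa>" using bnd(1)[OF mem[of 0 0]] d by auto
    have H: "\<bar>integral {-d..d} (?H w1 t) - integral {-d..d} (?H w2 t)\<bar> \<le> 2 * d * (\<Lambda> * norm (w1 - w2))"
      if t: "t \<in> {-d<..<d}" for t
    proof -
      have int_H: "?H w t integrable_on {-d..d}" for w :: "real^'N"
      proof -
        have "continuous_on ({-d..d} \<times> {-d..d}) (\<lambda>z. ?H w (fst z) (snd z))"
          using F_kernel_deriv(1)[of d "\<lambda>t \<beta>. K (p, t, \<beta>)" k', OF dk ck ck'] by (simp add: case_prod_unfold)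
        then have "continuous_on {-d..d} (\<lambda>\<beta>. ?H w (fst (t, \<beta>)) (snd (t, \<beta>)))"
          by (rule continuous_on_compose2) (use t in \<open>auto intro!: continuous_intros\<close>)
        then show ?thesis by (simp add: integrable_continuous_real)
      qed
      have "integral {-d..d} (?H w1 t) - integral {-d..d} (?H w2 t) = integral {-d..d} (\<lambda>\<beta>. ?H w1 t \<beta> - ?H w2 t \<beta>)"
        using int_H by (simp add: integral_diff)
      also have "\<bar>\<dots>\<bar> \<le> 2 * d * (\<Lambda> * norm (w1 - w2))"
        using d
      proof (rule abs_integral_le)
        fix \<beta> assume \<beta>: "\<beta> \<in> {-d<..<d}"
        have "\<bar>K (p, t, \<beta>)\<bar> \<le> \<kappa>" "\<bar>k' t \<beta>\<bar> \<le> \<kappa>"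
          using bnd(1)[OF mem[of t \<beta>]] bnd(2)[OF int[OF t \<beta>] e] t \<beta> by (auto simp: k'_def)
        then show "\<bar>?H w1 t \<beta> - ?H w2 t \<beta>\<bar> \<le> \<Lambda> * norm (w1 - w2)"
          unfolding \<Lambda>_def \<kappa> using B(2) w t \<beta> by (intro F_kernel_lipschitz) auto
      qed
      finally show ?thesis .
    qed
    have "\<bar>F_vec d mu K w1 p $ k - F_vec d mu K w2 p $ k\<bar> = \<bar>integral {-d..d} (\<lambda>t. ?g w1 t - ?g w2 t)\<bar>"
      unfolding F(1) integral_diff[OF F(2) F(2)] by linarith
    also have "\<dots> \<le> 2 * d * (m * (L + d) * (2 * d * (\<Lambda> * norm (w1 - w2))) * B)"
      using d
    proof (rule abs_integral_le)
      fix t assume t: "t \<in> {-d<..<d}"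
      have s: "snd p > 1" using p a by (auto simp: Omega_def)
      have "norm (p - (axis ix1 t, 0)) \<le> L + d"
      proof -
        have "norm (axis ix1 t :: real^'n) = \<bar>t\<bar>"
          by (subst axis_eq_scaleR) simp
        then have "norm ((axis ix1 t, 0) :: (real^'n) \<times> real) \<le> d"
          using t by (simp add: norm_Pair abs_le_iff)
        then show ?thesis using L(2)[OF p] norm_triangle_ineq4[of p "(axis ix1 t, 0)"] by linarith
      qed
      moreover have "\<bar>1 / snd (nu p t)\<bar> \<le> norm (p - (axis ix1 t, 0))"
        unfolding snd_nu using s by (simp add: divide_le_eq mult_le_cancel_left1)
      ultimately have n: "\<bar>1 / snd (nu p t)\<bar> \<le> L + d" by linarith
      have "?g w1 t - ?g w2 t = mu p * (1 / snd (nu p t)) *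
          (integral {-d..d} (?H w1 t) - integral {-d..d} (?H w2 t)) * Psi d (ix k) t"
        by (simp add: algebra_simps diff_divide_distrib)
      also have "\<bar>\<dots>\<bar> \<le> m * (L + d) * (2 * d * (\<Lambda> * norm (w1 - w2))) * B"
        unfolding abs_mult using m(1) m(2)[OF p] n H[OF t] B(1) B(2)[of t k] t L(1) d L0
        by (intro mult_mono) auto
      finally show "\<bar>?g w1 t - ?g w2 t\<bar> \<le> m * (L + d) * (2 * d * (\<Lambda> * norm (w1 - w2))) * B" .
    qed
    also have "\<dots> = C * norm (w1 - w2)" by (simp add: C_def)
    finally show ?thesis .
  qed
  show ?thesis
  proof (rule that[of "?n * C"])
    fix K :: "((real^'n) \<times> real) \<times> real \<times> real \<Rightarrow> real" and p :: "(real^'n) \<times> real" and w1 w2 :: "real^'N"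
    assume H: "C2_on (KDom A d a b) K" "C1_norm (KDom A d a b) K = \<kappa>"
      "p \<in> Omega A a b" "norm w1 \<le> M" "norm w2 \<le> M"
    have "norm (F_vec d mu K w1 p - F_vec d mu K w2 p)
        \<le> (\<Sum>k\<in>UNIV. \<bar>(F_vec d mu K w1 p - F_vec d mu K w2 p) $ k\<bar>)" by (rule norm_le_l1_cart)
    also have "\<dots> \<le> (\<Sum>k\<in>(UNIV :: 'N set). C * norm (w1 - w2))"
      using main[OF H] by (intro sum_mono) simp
    finally show "norm (F_vec d mu K w1 p - F_vec d mu K w2 p) \<le> ?n * C * norm (w1 - w2)" by simp
  qed (use C0 in simp)
qed

section \<open>Accuracy estimate\<close>

lemma grid_pt_in_Omega:
  assumes "J \<in> interior_ix m" "y \<in> {a<..<b}" "1 < m" "A > 0"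
  shows "(grid_pt A m J, y) \<in> Omega A a b"
proof -
  have "- A < grid_pt A m J $ i \<and> grid_pt A m J $ i < A" for i
  proof -
    have "1 \<le> J i" "J i \<le> m - 1" using assms(1) by (auto simp: interior_ix_def)
    then have J: "1 \<le> J i" "J i < m" using assms(3) by auto
    have "step A m > 0" using assms by (simp add: step_def)
    then have "real (J i) * step A m < real m * step A m" "0 < real (J i) * step A m"
      using J by simp_all
    moreover have "real m * step A m = 2 * A" using assms(3) by (simp add: step_def)
    ultimately show ?thesis by (simp add: grid_pt_def)
  qed
  then show ?thesis using assms(2) by (simp add: Omega_def)
qed

text \<open>Shaped to match \<open>sd_density\<close>: the sum over directions repeats the squares
  of the value and of the \<open>y\<close>-derivative, while the difference quotients occur once
  each. Cauchy-Schwarz for the sum of the Z i costs the factor n.\<close>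

lemma square_sum_le:
  fixes X Y :: real and Z :: "'n::finite \<Rightarrow> real"
  shows "(X + (\<Sum>i\<in>UNIV. Z i) + Y)\<^sup>2
    \<le> 3 * real CARD('n) * (\<Sum>i\<in>UNIV. Y\<^sup>2 + (Z i)\<^sup>2 + X\<^sup>2)"
proof -
  let ?n = "real CARD('n)" and ?S = "\<Sum>i\<in>UNIV. Z i"
  have n: "?n \<ge> 1" by (simp add: Suc_leI)
  have "(X + ?S + Y)\<^sup>2 \<le> 3 * (X\<^sup>2 + ?S\<^sup>2 + Y\<^sup>2)"
  proof -
    have "0 \<le> (X - ?S)\<^sup>2 + (X - Y)\<^sup>2 + (?S - Y)\<^sup>2" by simp
    then show ?thesis by (simp add: power2_eq_square algebra_simps)
  qed
  also have "\<dots> \<le> 3 * (X\<^sup>2 + ?n * (\<Sum>i\<in>UNIV. (Z i)\<^sup>2) + Y\<^sup>2)"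
    using sum_squared_le_sum_of_squares[of Z "UNIV :: 'n set"] by (simp add: mult.commute)
  also have "3 * (X\<^sup>2 + ?n * (\<Sum>i\<in>UNIV. (Z i)\<^sup>2) + Y\<^sup>2)
      \<le> 3 * (?n * ?n * X\<^sup>2 + ?n * (\<Sum>i\<in>UNIV. (Z i)\<^sup>2) + ?n * ?n * Y\<^sup>2)"
  proof -
    have "1 \<le> ?n * ?n" using n mult_mono[of 1 ?n 1 ?n] by simp
    then have "1 * X\<^sup>2 \<le> ?n * ?n * X\<^sup>2" "1 * Y\<^sup>2 \<le> ?n * ?n * Y\<^sup>2"
      by (intro mult_right_mono; simp)+
    then show ?thesis by simp
  qed
  also have "\<dots> = 3 * ?n * (\<Sum>i\<in>UNIV. Y\<^sup>2 + (Z i)\<^sup>2 + X\<^sup>2)"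
    by (simp add: sum.distrib algebra_simps)
  finally show ?thesis by simp
qed

lemma dx_add: "dx A m k (Q + V) J y = dx A m k Q J y + dx A m k V J y"
  using dx_lincomb[of A m k 1 Q 1 V] by (simp add: lincomb_simps)

text \<open>
  At an exact solution \<open>W\<close> the residual of \<open>W + V\<close> equals the difference of the two residuals, which
  is of first order in \<open>V\<close>.
\<close>

lemma Jfun_perturbed_solution:
  fixes A d a b R \<kappa> lam :: real and mu :: "(real^'n) \<times> real \<Rightarrow> real"
  assumes A: "A > 0" and d: "d > 0" and a: "1 < a" and ab: "a < b" and mu: "C2_on UNIV mu"
  obtains C where "C \<ge> 0"
    "\<And>K m (W :: ('n, 'N::finite) sdfun) V. C2_on (KDom A d a b) K \<Longrightarrow> C1_norm (KDom A d a b) K = \<kappa> \<Longrightarrow>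
      1 < m \<Longrightarrow> W \<in> H1h A a b m \<Longrightarrow> V \<in> H1h A a b m \<Longrightarrow>
      sd_norm A a b m W \<le> R \<Longrightarrow> sd_norm A a b m (W + V) \<le> R \<Longrightarrow>
      (\<forall>J\<in>interior_ix m. AE y in lebesgue_on {a<..<b}. residual A d m mu K W J y = 0) \<Longrightarrow>
      Jfun A d a b m mu K lam (W + V) \<le> C * (sd_norm A a b m V)\<^sup>2"
proof -
  \<comment> \<open>The pointwise bound of \<open>H1h_sup_bound\<close>: both W and W + V have norm
    at most \<open>R\<close>, so their values stay where the nonlinearity is Lipschitz.\<close>
  define M where "M = 2 * (b - a) + 1 + R\<^sup>2 / (b - a) + 2 * R\<^sup>2"
  have M: "M \<ge> 0" using ab by (simp add: M_def)
  obtain C1 where C1: "C1 \<ge> 0"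
    "\<And>p (v :: real^'N). p \<in> (Omega A a b :: ((real^'n) \<times> real) set) \<Longrightarrow> norm (D_mat d p *v v) \<le> C1 * norm v"
    "\<And>p (v :: real^'N) i. p \<in> (Omega A a b :: ((real^'n) \<times> real) set) \<Longrightarrow> norm (A_mat d i p *v v) \<le> C1 * norm v"
    using matrix_bounds[OF A d a] by blast
  obtain C2 where C2: "C2 \<ge> 0"
    "\<And>K p (w1 :: real^'N) w2. C2_on (KDom A d a b) K \<Longrightarrow> C1_norm (KDom A d a b) K = \<kappa> \<Longrightarrow>
      p \<in> Omega A a b \<Longrightarrow> norm w1 \<le> M \<Longrightarrow> norm w2 \<le> M \<Longrightarrow>
      norm (F_vec d mu K w1 p - F_vec d mu K w2 p) \<le> C2 * norm (w1 - w2)"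
    using F_lipschitz[OF d a mu M] by blast
  let ?n = "real CARD('n)" and ?C = "max C1 C2"
  \<comment> \<open>The first factor bounds the squared Carleman weight on (a, b), using 0 < y < b;
    the second is the squared Lipschitz constant of the operator together with the factor from
    \<open>square_sum_le\<close>.\<close>
  define C where "C = (exp (\<bar>lam\<bar> * b))\<^sup>2 * (?C\<^sup>2 * (3 * ?n))"
  have C: "C \<ge> 0" by (simp add: C_def)
  show ?thesis
  proof (rule that[OF C])
    fix K m and W V :: "('n, 'N) sdfun"
    assume K: "C2_on (KDom A d a b) K" "C1_norm (KDom A d a b) K = \<kappa>" and m: "1 < m"
      and W: "W \<in> H1h A a b m" and V: "V \<in> H1h A a b m"
      and R: "sd_norm A a b m W \<le> R" "sd_norm A a b m (W + V) \<le> R"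
      and res: "\<forall>J\<in>interior_ix m. AE y in lebesgue_on {a<..<b}. residual A d m mu K W J y = 0"
    let ?M = "lebesgue_on {a<..<b}"
    have "(LINT y|?M. (norm (exp (lam * y) *\<^sub>R residual A d m mu K (W + V) J y))\<^sup>2)
        \<le> (LINT y|?M. C * (\<Sum>k\<in>UNIV. sd_density A m k V J y))" if J: "J \<in> interior_ix m" for J
    \<comment> \<open>The right side is an integrable nonnegative majorant; a nonintegrable left
      side would have integral 0 by convention and so obey the same bound.\<close>
    proof (rule integral_mono_AE')
      show "integrable ?M (\<lambda>y. C * (\<Sum>k\<in>UNIV. sd_density A m k V J y))"
        using sd_density_integrable[OF V J] by simp
      show "AE y in ?M. 0 \<le> C * (\<Sum>k\<in>UNIV. sd_density A m k V J y)"
        using C by (simp add: sum_nonneg sd_density_nonneg)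
      have dyV: "AE y in ?M. dy (W + V) J y = dy W J y + dy V J y"
        using AE_dy_lincomb[OF W V J, of 1 1] by (simp add: lincomb_simps)
      have "AE y in ?M. residual A d m mu K W J y = 0" using res J by blast
      with dyV show "AE y in ?M. (norm (exp (lam * y) *\<^sub>R residual A d m mu K (W + V) J y))\<^sup>2
          \<le> C * (\<Sum>k\<in>UNIV. sd_density A m k V J y)"
        using AE_space
      proof eventually_elim
        fix y
        assume dy: "dy (W + V) J y = dy W J y + dy V J y" and r0: "residual A d m mu K W J y = 0"
          and "y \<in> space ?M"
        then have y: "y \<in> {a<..<b}" by simp
        let ?p = "(grid_pt A m J, y)"
        have p: "?p \<in> Omega A a b" using grid_pt_in_Omega[OF J y m A] .
        have bnd: "norm (W J y) \<le> M" "norm ((W + V) J y) \<le> M"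
          unfolding M_def using y
          by (intro H1h_sup_bound[OF W J ab _ R(1)] H1h_sup_bound[OF H1h_add[OF W V] J ab _ R(2)]; simp)+
        have "residual A d m mu K (W + V) J y
            = residual A d m mu K (W + V) J y - residual A d m mu K W J y" using r0 by simp
        also have "residual A d m mu K (W + V) J y - residual A d m mu K W J y = D_mat d ?p *v dy V J y + (\<Sum>i\<in>UNIV. A_mat d i ?p *v dx A m i V J y)
            + (F_vec d mu K ((W + V) J y) ?p - F_vec d mu K (W J y) ?p)"
          unfolding residual_def Let_def dy dx_add matrix_vector_right_distrib sum.distrib by simp
        finally have "norm (residual A d m mu K (W + V) J y) = norm (D_mat d ?p *v dy V J y
            + (\<Sum>i\<in>UNIV. A_mat d i ?p *v dx A m i V J y)
            + (F_vec d mu K ((W + V) J y) ?p - F_vec d mu K (W J y) ?p))" by (rule arg_cong)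
        also have "\<dots> \<le> C1 * norm (dy V J y) + (\<Sum>i\<in>UNIV. C1 * norm (dx A m i V J y)) + C2 * norm (V J y)"
        proof (intro norm_triangle_mono sum_norm_le)
          show "norm (F_vec d mu K ((W + V) J y) ?p - F_vec d mu K (W J y) ?p) \<le> C2 * norm (V J y)"
            using C2(2)[OF K p bnd(2,1)] by simp
        qed (use C1(2,3)[OF p] in auto)
        also have "\<dots> \<le> ?C * norm (dy V J y) + (\<Sum>i\<in>UNIV. ?C * norm (dx A m i V J y)) + ?C * norm (V J y)"
          by (intro add_mono sum_mono mult_right_mono) auto
        also have "\<dots> = ?C * (norm (dy V J y) + (\<Sum>i\<in>UNIV. norm (dx A m i V J y)) + norm (V J y))"
          by (simp add: sum_distrib_left distrib_left)
        finally have "(norm (residual A d m mu K (W + V) J y))\<^sup>2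
            \<le> ?C\<^sup>2 * (norm (dy V J y) + (\<Sum>i\<in>UNIV. norm (dx A m i V J y)) + norm (V J y))\<^sup>2"
          unfolding power_mult_distrib[symmetric] by (rule power_mono) simp
        also have "\<dots> \<le> ?C\<^sup>2 * (3 * ?n * (\<Sum>k\<in>UNIV. sd_density A m k V J y))"
          unfolding sd_density_def by (intro mult_left_mono square_sum_le) simp
        finally have r: "(norm (residual A d m mu K (W + V) J y))\<^sup>2
            \<le> ?C\<^sup>2 * (3 * ?n * (\<Sum>k\<in>UNIV. sd_density A m k V J y))" .
        have "lam * y \<le> \<bar>lam\<bar> * b"
          using y a by (intro mult_mono) auto
        then have e: "(exp (lam * y))\<^sup>2 \<le> (exp (\<bar>lam\<bar> * b))\<^sup>2" by (intro power_mono) auto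
        have "(norm (exp (lam * y) *\<^sub>R residual A d m mu K (W + V) J y))\<^sup>2
            = (exp (lam * y))\<^sup>2 * (norm (residual A d m mu K (W + V) J y))\<^sup>2"
          by (simp add: power_mult_distrib)
        also have "\<dots> \<le> (exp (\<bar>lam\<bar> * b))\<^sup>2 * (?C\<^sup>2 * (3 * ?n * (\<Sum>k\<in>UNIV. sd_density A m k V J y)))"
          using e r by (intro mult_mono) auto
        finally show "(norm (exp (lam * y) *\<^sub>R residual A d m mu K (W + V) J y))\<^sup>2
            \<le> C * (\<Sum>k\<in>UNIV. sd_density A m k V J y)"
          by (simp add: C_def mult.assoc)
      qed
    qed
    also have "(LINT y|?M. C * (\<Sum>k\<in>UNIV. sd_density A m k V J y))
        = C * (\<Sum>k\<in>UNIV. LINT y|?M. sd_density A m k V J y)" if J: "J \<in> interior_ix m" for J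
      using sd_density_integrable[OF V J] by (simp add: Bochner_Integration.integral_sum)
    finally have "(\<Sum>J\<in>interior_ix m. LINT y|?M. (norm (exp (lam * y) *\<^sub>R residual A d m mu K (W + V) J y))\<^sup>2)
        \<le> (\<Sum>J\<in>interior_ix m. C * (\<Sum>k\<in>UNIV. LINT y|?M. sd_density A m k V J y))"
      by (intro sum_mono)
    then have "(\<Sum>J\<in>interior_ix m. LINT y|?M. (norm (exp (lam * y) *\<^sub>R residual A d m mu K (W + V) J y))\<^sup>2)
        \<le> C * (sd_norm A a b m V)\<^sup>2"
      by (simp add: sd_norm_sq sum_distrib_left)
    then show "Jfun A d a b m mu K lam (W + V) \<le> C * (sd_norm A a b m V)\<^sup>2"
      unfolding Jfun_def sd_norm_L2_def
      by (simp add: sum_nonneg integral_nonneg_AE)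
  qed
qed

text \<open>\<open>C3\<close> is quantified before the kernel, the grid, the noise level and all
  boundary data. Hence it can depend on \<open>K\<close> only through \<kappa>, and is uniform over
  all grids with step at least \<open>h0\<close>. The convexity parameters \<open>lam2\<close> and
  \<open>c\<close> are likewise fixed in advance.\<close>

theorem theorem4p4:
  fixes A d a0 a b h0 R \<kappa> lam2 c :: real
    and mu :: "(real^'n) \<times> real \<Rightarrow> real"
  assumes "A > 0" and "d > 0" and "h0 > 0" and "R > 0"
    and "a0 > 1"
    and a0: "\<And>a' b'. a' \<ge> a0 \<Longrightarrow> a' < b' \<Longrightarrow>
      (\<forall>p\<in>closure (Omega A a' b' :: ((real^'n) \<times> real) set). invertible (D_mat d p :: real^'N^'N)) \<and>
      (\<exists>C. \<forall>p\<in>closure (Omega A a' b' :: ((real^'n) \<times> real) set).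
         onorm ((*v) (matrix_inv (D_mat d p :: real^'N^'N))) \<le> C)"
    and "a \<ge> a0" and "1 < a" and "a < b"
    and "C2_on UNIV mu" and "\<And>p. mu p \<ge> 0" and "\<And>p. p \<notin> Omega A a b \<Longrightarrow> mu p = 0"
  shows "\<exists>C3>0. \<forall>K :: ((real^'n) \<times> real) \<times> real \<times> real \<Rightarrow> real.
      C2_on (KDom A d a b) K \<and> (\<forall>q\<in>KDom A d a b. K q \<ge> 0) \<and> C1_norm (KDom A d a b) K = \<kappa> \<and>
      is_lambda1 A d a b h0 mu K TYPE('N) (2 * R) lam2 c \<longrightarrow>
      (\<forall>m \<delta> \<alpha>0 (P :: ('n, 'N) sdfun) (Pstar :: ('n, 'N) sdfun) Wstar S Sstar Wmin.
        1 < m \<and> step A m \<ge> h0 \<and> \<delta> > 0 \<and>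
        Wstar \<in> H1h A a b m \<and>
        (\<forall>J\<in>interior_ix m. AE y in lebesgue_on {a<..<b}. residual A d m mu K Wstar J y = 0) \<and>
        has_trace a b m Wstar Pstar \<and>
        S \<in> H1h A a b m \<and> has_trace a b m S P \<and> sd_norm A a b m S < R \<and>
        Sstar \<in> H1h A a b m \<and> has_trace a b m Sstar Pstar \<and> sd_norm A a b m Sstar < R \<and>
        sd_norm A a b m (S - Sstar) < \<delta> \<and>
        is_arg_min (Jfun A d a b m mu K lam2) (\<lambda>W. W \<in> Bclosure A a b m R P) Wmin \<and>
        0 < \<alpha>0 \<and> \<alpha>0 < R \<and> Wstar \<in> Bset A a b m (R - \<alpha>0) Pstar \<and> C3 * \<delta> < \<alpha>0 \<longrightarrow>
        Wmin \<in> Bset A a b m R P \<and>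
        sd_norm A a b m (Wmin - Wstar) \<le> C3 * \<delta>)"
proof -
  obtain C where C: "C \<ge> 0"
    "\<And>K m (W :: ('n, 'N) sdfun) V. C2_on (KDom A d a b) K \<Longrightarrow> C1_norm (KDom A d a b) K = \<kappa> \<Longrightarrow>
      1 < m \<Longrightarrow> W \<in> H1h A a b m \<Longrightarrow> V \<in> H1h A a b m \<Longrightarrow>
      sd_norm A a b m W \<le> R \<Longrightarrow> sd_norm A a b m (W + V) \<le> R \<Longrightarrow>
      (\<forall>J\<in>interior_ix m. AE y in lebesgue_on {a<..<b}. residual A d m mu K W J y = 0) \<Longrightarrow>
      Jfun A d a b m mu K lam2 (W + V) \<le> C * (sd_norm A a b m V)\<^sup>2"
    using Jfun_perturbed_solution[OF \<open>A > 0\<close> \<open>d > 0\<close> \<open>1 < a\<close> \<open>a < b\<close> \<open>C2_on UNIV mu\<close>] by blast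
  \<comment> \<open>Positivity of \<open>c\<close> is known only after \<open>is_lambda1\<close> is
    assumed, which happens under the quantifier over \<open>K\<close>; the absolute value keeps the
    square root below well behaved until then. In \<open>C3\<close> the 1 pays for the shift V and
    the root for the distance from Q to the minimizer.\<close>
  define c1 where "c1 = \<bar>c\<bar> * exp (2 * lam2 * a)"
  define C3 where "C3 = 1 + sqrt (2 * C / c1)"
  have "C3 \<ge> 1" using C(1) by (simp add: C3_def c1_def)
  show ?thesis
  proof (intro exI[of _ C3] conjI allI impI; (elim conjE)?)
    fix K :: "((real^'n) \<times> real) \<times> real \<times> real \<Rightarrow> real"
      and m :: nat and \<delta> \<alpha>0 :: real and P Pstar Wstar S Sstar Wmin :: "('n, 'N) sdfun"
    assume K: "C2_on (KDom A d a b) K" "C1_norm (KDom A d a b) K = \<kappa>"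
      and conv: "is_lambda1 A d a b h0 mu K TYPE('N) (2 * R) lam2 c"
      and m: "1 < m" "h0 \<le> step A m" and "0 < \<delta>"
      and Wstar: "Wstar \<in> H1h A a b m"
      and res: "\<forall>J\<in>interior_ix m. AE y in lebesgue_on {a<..<b}. residual A d m mu K Wstar J y = 0"
      and tr: "has_trace a b m Wstar Pstar" "has_trace a b m S P" "has_trace a b m Sstar Pstar"
      and S: "S \<in> H1h A a b m" "Sstar \<in> H1h A a b m"
      and \<delta>: "sd_norm A a b m (S - Sstar) < \<delta>"
      and min: "is_arg_min (Jfun A d a b m mu K lam2) (\<lambda>W. W \<in> Bclosure A a b m R P) Wmin"
      and \<alpha>0: "0 < \<alpha>0" "Wstar \<in> Bset A a b m (R - \<alpha>0) Pstar" "C3 * \<delta> < \<alpha>0"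
    let ?N = "sd_norm A a b m"
    define V where "V = S - Sstar"
    define Q where "Q = Wstar + V"
    have V: "V \<in> H1h A a b m" "?N V < \<delta>" unfolding V_def using S \<delta> by (simp_all add: H1h_diff)
    have Q: "Q \<in> H1h A a b m" unfolding Q_def using Wstar V(1) by (rule H1h_add)
    \<comment> \<open>Since C3 \<ge> 1, the gap \<alpha>0 also exceeds \<delta>, so the shifted
      solution stays in the open ball of radius \<open>R\<close> and is a legitimate
      competitor.\<close>
    have "\<delta> \<le> C3 * \<delta>" using \<open>C3 \<ge> 1\<close> \<open>0 < \<delta>\<close> by simp
    then have NQ: "?N Q < R"
      using sd_norm_add_le[OF Wstar V(1)] V(2) \<alpha>0 by (simp add: Q_def Bset_def)
    have "has_trace a b m Q P"
      using tr by (fastforce simp: has_trace_def Q_def V_def)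
    then have QB: "Q \<in> Bset A a b m R P" using Q NQ by (simp add: Bset_def)
    have Wmin: "Wmin \<in> H1h A a b m" "has_trace a b m Wmin P"
      using min by (auto simp: is_arg_min_def Bclosure_def)
    have c: "c1 = c * exp (2 * lam2 * a)" "c1 > 0" using conv by (auto simp: is_lambda1_def c1_def)
    have "Jfun A d a b m mu K lam2 Q \<le> C * (?N V)\<^sup>2"
      unfolding Q_def using K m(1) Wstar V(1) _ _ res
      by (rule C(2)) (use \<alpha>0 NQ in \<open>auto simp: Bset_def Q_def\<close>)
    also have "\<dots> \<le> C * \<delta>\<^sup>2"
      using V(2) C(1) by (intro mult_left_mono power_mono) (auto simp: sd_norm_nonneg)
    finally have "c1 * (?N (Q - Wmin))\<^sup>2 \<le> 2 * (C * \<delta>\<^sup>2)"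
      using minimizer_distance_le[OF conv \<open>R > 0\<close> m min QB] unfolding c(1) by linarith
    then have "(?N (Q - Wmin))\<^sup>2 \<le> 2 * C / c1 * \<delta>\<^sup>2"
      using c(2) by (simp add: field_simps)
    then have "?N (Q - Wmin) \<le> sqrt (2 * C / c1 * \<delta>\<^sup>2)" by (rule real_le_rsqrt)
    also have "\<dots> = sqrt (2 * C / c1) * \<delta>" using \<open>0 < \<delta>\<close> by (simp only: real_sqrt_mult real_sqrt_abs abs_of_pos)
    finally have "?N (Wmin - Q) \<le> sqrt (2 * C / c1) * \<delta>"
      using sd_norm_minus_commute[OF Q Wmin(1)] by simp
    moreover have eq: "Wmin - Wstar = (Wmin - Q) + V" by (simp add: Q_def)
    ultimately have dist: "?N (Wmin - Wstar) \<le> C3 * \<delta>"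
      using sd_norm_add_le[OF H1h_diff[OF Wmin(1) Q] V(1)] V(2)
      unfolding eq C3_def distrib_right by linarith
    then show "?N (Wmin - Wstar) \<le> C3 * \<delta>" .
    have "?N Wmin \<le> ?N (Wmin - Wstar) + ?N Wstar"
      using sd_norm_add_le[OF H1h_diff[OF Wmin(1) Wstar] Wstar] by simp
    then have "?N Wmin < R" using dist \<alpha>0 by (simp add: Bset_def)
    then show "Wmin \<in> Bset A a b m R P" using Wmin by (simp add: Bset_def)
  qed (use \<open>C3 \<ge> 1\<close> in simp)
qed

end
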